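(* Suppose $k\in C^{1,0}(\bar Q_T)$, $q,f\in C(\bar Q_T)$, $k(x,t)\ge c_1>0$ and $q(x,t)\ge 0$ everywhere on $\bar Q_T$. Let $u\in C^{2,1}(\bar Q_T)$ be a solution of the Dirichlet problem $$\mathbb{P}^{(\theta)}_{(\omega)}(\partial_{0t})u(x,t)=\frac{\partial}{\partial x}\Big(k(x,t)\frac{\partial u}{\partial x}\Big)-q(x,t)u+f(x,t),\quad 0<x<l,\ 0<t\le T,$$ $$u(0,t)=0,\quad u(l,t)=0,\quad 0\le t\le T,\qquad u(x,0)=u_0(x),\quad 0\le x\le l.$$ Then for all $t\in(0,T]$ the following a priori estimate holds: $$\int_0^l \mathbb{P}^{(\theta-1)}_{(\omega)}(D_{0t})u^2(x,t)\,dx+c_1\int_0^t\|u_x(x,s)\|_0^2\,ds\le \frac{l^2}{2c_1}\int_0^t\|f(x,s)\|_0^2\,ds+\int_0^l u_0^2(x)\Big(\int_\alpha^\beta\sum_{r=1}^m\frac{\omega_r(x,\gamma)\,t^{1-\theta_r(x,\gamma)}}{\Gamma(2-\theta_r(x,\gamma))}\,d\gamma\Big)dx.$$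
   Context: Let $l,T>0$, $\alpha<\beta$ real, $m\ge 1$ an integer, and $\bar Q_T=\{(x,t):0\le x\le l,\ 0\le t\le T\}$. $C^{m,n}(\bar Q_T)$ is the class of functions continuous on $\bar Q_T$ together with their partial derivatives of order up to $m$ in $x$ and up to $n$ in $t$. Standing assumptions: for $r=1,\dots,m$, $\theta_r$ is continuous on $[0,l]\times[\alpha,\beta]$ with $0<\theta_r(x,\gamma)<1$; $\omega_r(x,\gamma)\ge 0$ on $[0,l]\times[\alpha,\beta]$, with $\omega_r$ Lebesgue integrable on $[0,l]\times[\alpha,\beta]$ and $\omega_r(x,\cdot)$ integrable on $[\alpha,\beta]$ for each $x$; $\int_\alpha^\beta\sum_{r=1}^m\omega_r(x,\gamma)\,d\gamma>0$ for all $x\in[0,l]$; and $k(x,t)\le c_2$ on $\bar Q_T$ for some constant $c_2$. For $0<\theta<1$ the Caputo derivative of order $\theta$ is $\partial_{0t}^{\theta}u(x,t)=\frac{1}{\Gamma(1-\theta)}\int_0^t\frac{u_\eta(x,\eta)}{(t-\eta)^{\theta}}\,d\eta$, and for $\nu>0$ the Riemann–Liouville integral of order $\nu$ is $D_{0t}^{-\nu}u(x,t)=\frac1{\Gamma(\nu)}\int_0^t(t-s)^{\nu-1}u(x,s)\,ds$. Define $$\mathbb{P}^{(\theta)}_{(\omega)}(\partial_{0t})u(x,t)=\int_\alpha^\beta\sum_{r=1}^m\omega_r(x,\gamma)\,\partial_{0t}^{\theta_r(x,\gamma)}u(x,t)\,d\gamma,$$ $$\mathbb{P}^{(\theta-1)}_{(\omega)}(D_{0t})u(x,t)=\int_\alpha^\beta\sum_{r=1}^m\omega_r(x,\gamma)\,D_{0t}^{\theta_r(x,\gamma)-1}u(x,t)\,d\gamma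 .$$ In $\mathbb{P}^{(\theta-1)}_{(\omega)}(D_{0t})u^2(x,t)$ the operator is applied to the function $u^2$. The norm is $\|u\|_0^2=\|u(x,t)\|_0^2=\int_0^l u^2(x,t)\,dx$ (integration over $x$ at fixed time). *)

theory Defs
  imports "HOL-Analysis.Analysis"
begin

text \<open>Functions of \<open>(x, t)\<close> are curried, \<open>u x t\<close>; they matter only on \<open>{0..l} \<times> {0..T}\<close>.
  Partial derivatives are taken within the closed rectangle, hence are one-sided on its boundary.\<close>

definition partial_x :: "real \<Rightarrow> (real \<Rightarrow> real \<Rightarrow> real) \<Rightarrow> real \<Rightarrow> real \<Rightarrow> real" where
  "partial_x l u x t = vector_derivative (\<lambda>y. u y t) (at x within {0..l})"

definition partial_t :: "real \<Rightarrow> (real \<Rightarrow> real \<Rightarrow> real) \<Rightarrow> real \<Rightarrow> real \<Rightarrow> real" where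
  "partial_t T u x t = vector_derivative (\<lambda>s. u x s) (at t within {0..T})"

text \<open>The class \<open>C\<^sup>m\<^sup>,\<^sup>n\<close> on the closed rectangle: pure derivatives only, no mixed ones.
  Since \<^const>\<open>vector_derivative\<close> is total, their existence is required separately.\<close>

definition C_class :: "real \<Rightarrow> real \<Rightarrow> nat \<Rightarrow> nat \<Rightarrow> (real \<Rightarrow> real \<Rightarrow> real) \<Rightarrow> bool" where
  "C_class l T m n u \<longleftrightarrow>
     (\<forall>i<m. \<forall>x\<in>{0..l}. \<forall>t\<in>{0..T}.
        (\<lambda>y. (partial_x l ^^ i) u y t) differentiable (at x within {0..l})) \<and>
     (\<forall>j<n. \<forall>x\<in>{0..l}. \<forall>t\<in>{0..T}.
        (\<lambda>s. (partial_t T ^^ j) u x s) differentiable (at t within {0..T})) \<and>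
     (\<forall>i\<le>m. continuous_on ({0..l} \<times> {0..T}) (\<lambda>(x, t). (partial_x l ^^ i) u x t)) \<and>
     (\<forall>j\<le>n. continuous_on ({0..l} \<times> {0..T}) (\<lambda>(x, t). (partial_t T ^^ j) u x t))"

text \<open>The fractional operators act on the time function \<open>v\<close>. Integrating over the open
  interval keeps \<^const>\<open>deriv\<close>, which is two-sided, away from the endpoints.\<close>

definition caputo :: "real \<Rightarrow> (real \<Rightarrow> real) \<Rightarrow> real \<Rightarrow> real" where
  "caputo \<theta> v t =
     1 / Gamma (1 - \<theta>) * (LINT \<eta>:{0<..<t}|lebesgue. deriv v \<eta> / (t - \<eta>) powr \<theta>)"

text \<open>\<open>rl_integral \<nu>\<close> is the Riemann-Liouville integral of order \<open>\<nu> > 0\<close>, written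
  \<open>D\<close> with exponent \<open>- \<nu>\<close>; thus exponent \<open>\<theta> - 1\<close> corresponds to \<open>\<nu> = 1 - \<theta>\<close>.\<close>

definition rl_integral :: "real \<Rightarrow> (real \<Rightarrow> real) \<Rightarrow> real \<Rightarrow> real" where
  "rl_integral \<nu> v t =
     1 / Gamma \<nu> * (LINT s:{0<..<t}|lebesgue. (t - s) powr (\<nu> - 1) * v s)"

definition P_caputo ::
  "nat \<Rightarrow> real \<Rightarrow> real \<Rightarrow> (nat \<Rightarrow> real \<Rightarrow> real \<Rightarrow> real) \<Rightarrow> (nat \<Rightarrow> real \<Rightarrow> real \<Rightarrow> real) \<Rightarrow>
   (real \<Rightarrow> real \<Rightarrow> real) \<Rightarrow> real \<Rightarrow> real \<Rightarrow> real" where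
  "P_caputo m \<alpha> \<beta> \<omega> \<theta> u x t =
     (LINT \<gamma>:{\<alpha>..\<beta>}|lebesgue. \<Sum>r=1..m. \<omega> r x \<gamma> * caputo (\<theta> r x \<gamma>) (u x) t)"

definition P_rl ::
  "nat \<Rightarrow> real \<Rightarrow> real \<Rightarrow> (nat \<Rightarrow> real \<Rightarrow> real \<Rightarrow> real) \<Rightarrow> (nat \<Rightarrow> real \<Rightarrow> real \<Rightarrow> real) \<Rightarrow>
   (real \<Rightarrow> real \<Rightarrow> real) \<Rightarrow> real \<Rightarrow> real \<Rightarrow> real" where
  "P_rl m \<alpha> \<beta> \<omega> \<theta> u x t =
     (LINT \<gamma>:{\<alpha>..\<beta>}|lebesgue. \<Sum>r=1..m. \<omega> r x \<gamma> * rl_integral (1 - \<theta> r x \<gamma>) (u x) t)"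

definition norm0_sq :: "real \<Rightarrow> (real \<Rightarrow> real) \<Rightarrow> real" where
  "norm0_sq l v = (LINT x:{0..l}|lebesgue. (v x)\<^sup>2)"

end

theory Submission
  imports Defs
begin

text \<open>Multiply the equation by \<open>u\<close> and integrate over \<open>x\<close> and over time. On the right-hand side,
  integration by parts, the Poincare inequality \<open>\<integral> u\<^sup>2 \<le> l\<^sup>2 / 2 \<integral> u\<^sub>x\<^sup>2\<close> and
  \<open>f u \<le> l\<^sup>2 / (4 c\<^sub>1) f\<^sup>2 + c\<^sub>1 / l\<^sup>2 u\<^sup>2\<close> leave half of the term \<open>c\<^sub>1 u\<^sub>x\<^sup>2\<close>. On the left-hand side, Alikhanov's
  inequality \<open>2 v \<partial>\<^sup>\<theta>v \<ge> \<partial>\<^sup>\<theta>(v\<^sup>2)\<close> applies for each \<open>\<gamma>\<close>, and the time integral of \<open>\<partial>\<^sup>\<theta>(v\<^sup>2)\<close> is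
  \<open>D\<^sup>\<theta>\<^sup>-\<^sup>1 v\<^sup>2 - v(0)\<^sup>2 t\<^sup>1\<^sup>-\<^sup>\<theta> / \<Gamma>(2 - \<theta>)\<close>.
  The right-hand side of the equation is continuous up to the boundary, so no joint regularity in
  \<open>(x, t)\<close> of the distributed-order operator has to be proved; it is inherited from the equation.\<close>

section \<open>Weakly singular convolutions\<close>

text \<open>The equation is available only for 0 < x < l and positive times, and the fractional term
  comes with no measurability in x. The two sides are therefore handled in opposite orders. For
  fixed x, the fractional term times u is integrated over the order and over time; for fixed time,
  the spatial terms are integrated over x. They meet in J(x), the time integral of u times the
  right-hand side of the equation, which is bounded below for each x and above after integration
  over x. Only for this continuous integrand are x and time exchanged. A Lebesgue integral defaults
  to 0 when the function is not integrable, so integrability in x of the fractional integral and of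
  the initial term is a real obligation. It is delicate because the weights are merely Lebesgue
  measurable in x and the order parameter jointly. The constants fit together as follows: the weight
  c1/l^2 in the estimate of f u is chosen so that its product with l^2/2 from the Poincare
  inequality is c1/2, and Alikhanov's factor 2 turns c1/2 and l^2/(4 c1) into c1 and l^2/(2
  c1).\<close>

lemma lborel_set_integral_eq_integral:
  fixes f :: "real \<Rightarrow> real"
  assumes "f \<in> borel_measurable borel" "S \<in> sets borel" "set_integrable lebesgue S f"
  shows "set_integrable lborel S f" "(LINT x:S|lborel. f x) = (LINT x:S|lebesgue. f x)"
proof -
  have m: "(\<lambda>x. indicator S x *\<^sub>R f x) \<in> borel_measurable lborel"
    using assms by simp
  show "set_integrable lborel S f"
    using assms(3) m unfolding set_integrable_def by (simp add: integrable_completion)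
  show "(LINT x:S|lborel. f x) = (LINT x:S|lebesgue. f x)"
    unfolding set_lebesgue_integral_def using m by (simp add: integral_completion)
qed

text \<open>The gauge integral of a nonnegative function is automatically absolute, which transfers
  the known value of the improper integral to Lebesgue measure. The endpoints are dropped as null
  sets.\<close>

lemma powr_kernel_from_0:
  fixes \<theta> c :: real
  assumes "\<theta> < 1" "0 \<le> c"
  shows "has_bochner_integral lborel (\<lambda>s. indicator {0<..<c} s * s powr (-\<theta>)) (c powr (1-\<theta>) / (1-\<theta>))"
proof -
  have hk: "((\<lambda>s. s powr (-\<theta>)) has_integral c powr (1-\<theta>) / (1-\<theta>)) {0..c}"
    using has_integral_powr_from_0[of "-\<theta>" c] assms by (simp add: add.commute)
  have si: "set_integrable lebesgue {0..c} (\<lambda>s. s powr (-\<theta>))"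
    using hk by (intro nonnegative_absolutely_integrable_1) (auto simp: integrable_on_def)
  have v: "(LINT s:{0..c}|lebesgue. s powr (-\<theta>)) = c powr (1-\<theta>) / (1-\<theta>)"
    using set_lebesgue_integral_eq_integral(2)[OF si] hk by (simp add: integral_unique)
  have "has_bochner_integral lborel (\<lambda>s. indicator {0..c} s * s powr (-\<theta>)) (c powr (1-\<theta>) / (1-\<theta>))"
    using lborel_set_integral_eq_integral[OF _ _ si] v
    by (simp add: has_bochner_integral_iff set_integrable_def set_lebesgue_integral_def)
  moreover have "AE s in lborel. indicator {0..c} s * s powr (-\<theta>) = indicator {0<..<c} s * s powr (-\<theta>)"
    using AE_lborel_singleton[of 0] AE_lborel_singleton[of c]
    by eventually_elim (auto simp: indicator_def)
  ultimately show ?thesis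
    by (subst has_bochner_integral_cong_AE[symmetric, of "\<lambda>s. indicator {0..c} s * s powr (-\<theta>)"]) auto
qed

lemma powr_kernel_left:
  fixes \<theta> a b :: real
  assumes "\<theta> < 1" "a \<le> b"
  shows "has_bochner_integral lborel (\<lambda>s. indicator {a<..<b} s * (s-a) powr (-\<theta>)) ((b-a) powr (1-\<theta>) / (1-\<theta>))"
proof -
  have "has_bochner_integral lborel (\<lambda>x. indicator {0<..<b-a} (-a + 1 * x) * (-a + 1 * x) powr (-\<theta>))
      ((b-a) powr (1-\<theta>) / (1-\<theta>) /\<^sub>R \<bar>1\<bar>)"
    using powr_kernel_from_0[of \<theta> "b-a"] assms
    by (intro lborel_has_bochner_integral_real_affine_iff[THEN iffD1]) auto
  moreover have "(\<lambda>x. indicator {0<..<b-a} (-a + 1 * x) * (-a + 1 * x) powr (-\<theta>))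
     = (\<lambda>s. indicator {a<..<b} s * (s-a) powr (-\<theta>))"
    by (auto simp: indicator_def fun_eq_iff)
  ultimately show ?thesis by simp
qed

lemma powr_kernel_right:
  fixes \<theta> a b :: real
  assumes "\<theta> < 1" "a \<le> b"
  shows "has_bochner_integral lborel (\<lambda>s. indicator {a<..<b} s * (b-s) powr (-\<theta>)) ((b-a) powr (1-\<theta>) / (1-\<theta>))"
proof -
  have "has_bochner_integral lborel (\<lambda>x. indicator {0<..<b-a} (b + (-1) * x) * (b + (-1) * x) powr (-\<theta>))
      ((b-a) powr (1-\<theta>) / (1-\<theta>) /\<^sub>R \<bar>-1\<bar>)"
    using powr_kernel_from_0[of \<theta> "b-a"] assms
    by (intro lborel_has_bochner_integral_real_affine_iff[THEN iffD1]) auto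
  moreover have "(\<lambda>x. indicator {0<..<b-a} (b + (-1) * x) * (b + (-1) * x) powr (-\<theta>))
     = (\<lambda>s. indicator {a<..<b} s * (b-s) powr (-\<theta>))"
    by (auto simp: indicator_def fun_eq_iff)
  ultimately show ?thesis by simp
qed

text \<open>The Caputo derivative and the Riemann-Liouville integral of order \<open>1 - \<theta>\<close> are both
  \<open>1 / \<Gamma>(1 - \<theta>)\<close> times this convolution, applied to \<open>u\<^sub>t\<close> and to \<open>u\<close>.\<close>

definition abel :: "real \<Rightarrow> (real \<Rightarrow> real) \<Rightarrow> real \<Rightarrow> real" where
  "abel \<theta> g s = (LINT \<eta>:{0<..<s}|lborel. (s - \<eta>) powr (-\<theta>) * g \<eta>)"

text \<open>Measurability is asked of a Borel function \<open>g\<close> agreeing with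
  \<open>v\<close> on the open interval, because \<open>v\<close> is controlled nowhere else; this
  permits the passage from \<open>lebesgue\<close> to \<open>lborel\<close>. The reciprocal
  \<open>rGamma\<close> is preferred to \<open>1 / Gamma\<close> because it is continuous on the
  whole line, hence measurable and bounded along continuous orders.\<close>

lemma rl_integral_eq_abel:
  assumes "g \<in> borel_measurable borel" "\<And>\<eta>. 0 < \<eta> \<Longrightarrow> \<eta> < s \<Longrightarrow> v \<eta> = g \<eta>"
  shows "rl_integral (1 - \<theta>) v s = rGamma (1 - \<theta>) * abel \<theta> g s"
proof -
  have "(LINT \<eta>:{0<..<s}|lebesgue. (s - \<eta>) powr (1 - \<theta> - 1) * v \<eta>)
      = (LINT \<eta>:{0<..<s}|lebesgue. (s - \<eta>) powr (-\<theta>) * g \<eta>)"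
    by (rule set_lebesgue_integral_cong) (use assms(2) in auto)
  also have "\<dots> = abel \<theta> g s"
    unfolding abel_def set_lebesgue_integral_def using assms(1)
    by (intro integral_completion) measurable
  finally show ?thesis
    unfolding rl_integral_def by (simp add: rGamma_inverse_Gamma field_simps)
qed

lemma caputo_eq_abel:
  assumes "g \<in> borel_measurable borel" "\<And>\<eta>. 0 < \<eta> \<Longrightarrow> \<eta> < s \<Longrightarrow> (v has_real_derivative g \<eta>) (at \<eta>)"
  shows "caputo \<theta> v s = rGamma (1 - \<theta>) * abel \<theta> g s"
proof -
  have "(LINT \<eta>:{0<..<s}|lebesgue. deriv v \<eta> / (s - \<eta>) powr \<theta>)
      = (LINT \<eta>:{0<..<s}|lebesgue. (s - \<eta>) powr (-\<theta>) * g \<eta>)"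
    by (rule set_lebesgue_integral_cong)
       (use assms(2) in \<open>auto simp: powr_minus_divide dest!: DERIV_imp_deriv\<close>)
  also have "\<dots> = abel \<theta> g s"
    unfolding abel_def set_lebesgue_integral_def using assms(1)
    by (intro integral_completion) measurable
  finally show ?thesis
    unfolding caputo_def by (simp add: rGamma_inverse_Gamma field_simps)
qed

lemma abel_integrable:
  assumes "\<theta> < 1" "g \<in> borel_measurable borel" "\<And>\<eta>. 0 < \<eta> \<Longrightarrow> \<eta> < s \<Longrightarrow> \<bar>g \<eta>\<bar> \<le> M"
  shows "set_integrable lborel {0<..<s} (\<lambda>\<eta>. (s - \<eta>) powr (-\<theta>) * g \<eta>)"
    and "0 \<le> s \<Longrightarrow> \<bar>abel \<theta> g s\<bar> \<le> M * (s powr (1-\<theta>) / (1-\<theta>))"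
proof -
  have k: "set_integrable lborel {0<..<s} (\<lambda>\<eta>. (s - \<eta>) powr (-\<theta>) * M)"
  proof (cases "0 \<le> s")
    case True
    then show ?thesis
      using powr_kernel_right[of \<theta> 0 s] assms(1)
      by (auto simp: set_integrable_def has_bochner_integral_iff mult.assoc[symmetric])
  qed (simp add: set_integrable_def)
  show i: "set_integrable lborel {0<..<s} (\<lambda>\<eta>. (s - \<eta>) powr (-\<theta>) * g \<eta>)"
    by (rule set_integrable_bound[OF k])
       (use assms(2,3) in \<open>auto simp: set_borel_measurable_def abs_mult intro!: mult_left_mono order_trans[OF assms(3) abs_ge_self]\<close>)
  assume s: "0 \<le> s"
  have "\<bar>abel \<theta> g s\<bar> \<le> (LINT \<eta>:{0<..<s}|lborel. norm ((s - \<eta>) powr (-\<theta>) * g \<eta>))"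
    unfolding abel_def using set_integral_norm_bound[OF i] by simp
  also have "\<dots> \<le> (LINT \<eta>:{0<..<s}|lborel. (s - \<eta>) powr (-\<theta>) * M)"
    by (rule set_integral_mono[OF set_integrable_norm[OF i] k])
       (use assms(3) in \<open>auto simp: abs_mult intro!: mult_left_mono\<close>)
  also have "\<dots> = M * (s powr (1-\<theta>) / (1-\<theta>))"
    using powr_kernel_right[of \<theta> 0 s] assms(1) s
    by (simp add: has_bochner_integral_iff set_lebesgue_integral_def)
  finally show "\<bar>abel \<theta> g s\<bar> \<le> M * (s powr (1-\<theta>) / (1-\<theta>))" .
qed

text \<open>Order, function and endpoint may all depend on the parameter. The moving interval
  becomes a case distinction in the integrand, so the integral runs over a fixed sigma-finite space
  and measurability of parametric integrals applies. The parameter is later the order variable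
  alone, paired with time, or paired with x.\<close>

lemma measurable_abel:
  assumes [measurable]: "\<tau> \<in> borel_measurable M" "b \<in> borel_measurable M"
    "case_prod g \<in> borel_measurable (M \<Otimes>\<^sub>M borel)"
  shows "(\<lambda>p. abel (\<tau> p) (g p) (b p)) \<in> borel_measurable M"
proof -
  have e: "abel (\<tau> p) (g p) (b p) = (LINT \<eta>|lborel. (if 0 < \<eta> \<and> \<eta> < b p then (b p - \<eta>) powr (- \<tau> p) * g p \<eta> else 0))" for p
    unfolding abel_def set_lebesgue_integral_def by (rule Bochner_Integration.integral_cong) auto
  show ?thesis unfolding e by measurable
qed

section \<open>Alikhanov's inequality and the time integral of the convolution\<close>

lemma continuous_on_Icc_bounded:
  fixes g :: "real \<Rightarrow> real"
  assumes "continuous_on UNIV g"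
  obtains M where "\<And>\<eta>. \<eta> \<in> {a..b} \<Longrightarrow> \<bar>g \<eta>\<bar> \<le> M"
proof -
  have "bounded (g ` {a..b})"
    by (intro compact_imp_bounded compact_continuous_image continuous_on_subset[OF assms]) auto
  then obtain M where "\<forall>y \<in> g ` {a..b}. norm y \<le> M"
    unfolding bounded_iff by blast
  then show thesis by (intro that[of M]) auto
qed

text \<open>Write \<open>K(\<eta>) = (s - \<eta>)\<^sup>-\<^sup>\<theta>\<close> and \<open>d(\<eta>) = v(s) - v(\<eta>)\<close>. The difference of the two sides is the
  integral of \<open>K d v'\<close>, and \<open>K d v' = - (K d\<^sup>2 / 2)' + K' d\<^sup>2 / 2\<close> with \<open>K' \<ge> 0\<close>; the boundary term at
  \<open>\<eta> = s\<close> vanishes because \<open>v\<close> is Lipschitz.\<close>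

lemma abel_Alikhanov:
  fixes v g :: "real \<Rightarrow> real"
  assumes \<theta>: "0 < \<theta>" "\<theta> < 1" and s: "0 < s"
    and v: "continuous_on UNIV v" and g: "continuous_on UNIV g"
    and deriv: "\<And>\<eta>. 0 < \<eta> \<Longrightarrow> \<eta> < s \<Longrightarrow> (v has_real_derivative g \<eta>) (at \<eta>)"
  shows "abel \<theta> (\<lambda>\<eta>. v \<eta> * g \<eta>) s \<le> v s * abel \<theta> g s"
proof -
  obtain M where M: "\<And>\<eta>. \<eta> \<in> {0..s} \<Longrightarrow> \<bar>g \<eta>\<bar> \<le> M"
    using continuous_on_Icc_bounded[OF g] by metis
  obtain M2 where M2: "\<And>\<eta>. \<eta> \<in> {0..s} \<Longrightarrow> \<bar>v \<eta> * g \<eta>\<bar> \<le> M2"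
    using continuous_on_Icc_bounded[OF continuous_on_mult[OF v g]] by metis
  have [measurable]: "v \<in> borel_measurable borel" "g \<in> borel_measurable borel"
    using v g by (auto intro: borel_measurable_continuous_onI)
  define p where "p \<eta> = (s - \<eta>) powr (-\<theta>) * (v s - v \<eta>)" for \<eta>
  have lip: "\<bar>v s - v \<eta>\<bar> \<le> M * (s - \<eta>)" if "\<eta> \<in> {0..s}" for \<eta>
  proof (cases "\<eta> = s")
    case False
    then have "\<eta> < s" using that by simp
    have d: "(v has_derivative (*) (g z)) (at z)" if "\<eta> < z" "z < s" for z
      using deriv[of z] that \<open>\<eta> \<in> {0..s}\<close> by (simp add: has_field_derivative_def)
    obtain z where z: "\<eta> < z" "z < s" "v s - v \<eta> = g z * (s - \<eta>)"
      using mvt[OF \<open>\<eta> < s\<close> continuous_on_subset[OF v subset_UNIV] d] by blast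
    show ?thesis using z M[of z] that \<open>\<eta> < s\<close> by (auto simp: abs_mult)
  qed simp
  have p_le: "norm (p \<eta>) \<le> M * (s - \<eta>) powr (1 - \<theta>)" if "\<eta> \<in> {0..s}" for \<eta>
  proof (cases "\<eta> = s")
    case False
    then have "(s - \<eta>) powr (1 - \<theta>) = (s - \<eta>) powr (-\<theta>) * (s - \<eta>)"
      using that powr_mult_base[of "s-\<eta>" "-\<theta>"] by (simp add: mult.commute)
    then show ?thesis
      using mult_left_mono[OF lip[OF that], of "(s - \<eta>) powr (-\<theta>)"]
      by (simp add: p_def abs_mult mult_ac)
  qed (simp add: p_def)
  \<comment> \<open>The singularity of the kernel at \<open>s\<close> is compensated by the
    Lipschitz bound: the majorant is a multiple of (s - \<eta>)^(1 - \<theta>), which tends to 0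
    because \<theta> < 1. The value \<open>p s\<close> is 0 because v(s) - v(s) = 0.\<close>
  have p_cont: "continuous_on {0..s} p"
    unfolding continuous_on_eq_continuous_within
  proof
    fix x assume x: "x \<in> {0..s}"
    show "continuous (at x within {0..s}) p"
    proof (cases "x = s")
      case True
      have "((\<lambda>\<eta>. M * (s - \<eta>) powr (1 - \<theta>)) \<longlongrightarrow> M * (s - s) powr (1 - \<theta>)) (at s within {0..s})"
        using \<theta> s
        by (intro tendsto_intros tendsto_powr' disjI2) (auto simp: eventually_at_filter)
      then have "(p \<longlongrightarrow> 0) (at s within {0..s})"
        using p_le \<theta>
        by (intro Lim_null_comparison[of p "\<lambda>\<eta>. M * (s - \<eta>) powr (1 - \<theta>)"])
           (auto simp: eventually_at_filter)
      then show ?thesis by (simp add: continuous_within True p_def)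
    next
      case False
      have "isCont v x" using v by (simp add: continuous_on_eq_continuous_at)
      then have "isCont p x"
        unfolding p_def using x False by (intro continuous_intros) auto
      then show ?thesis by (rule continuous_at_imp_continuous_at_within)
    qed
  qed
  define h where "h \<eta> = p \<eta> * g \<eta>" for \<eta>
  have h_cont: "continuous_on {0..s} h"
    unfolding h_def by (intro continuous_intros p_cont continuous_on_subset[OF g]) auto
  \<comment> \<open>Adding K d^2 / 2 to the primitive of \<open>h\<close> = K d v' leaves the
    derivative K' d^2 / 2 \<ge> 0, so monotonicity replaces the integral of the more singular K'
    d^2, which never has to be formed. At 0 only the nonnegative term K d^2 / 2 remains, and
    \<open>F s\<close> is exactly the integral of \<open>h\<close>.\<close>
  define F where "F \<eta> = integral {0..\<eta>} h + 1/2 * (p \<eta> * (v s - v \<eta>))" for \<eta>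
  have "F 0 \<le> F s"
  proof (rule DERIV_nonneg_imp_increasing_open[of 0 s F])
    show "0 \<le> s" using s by simp
    show "continuous_on {0..s} F"
      unfolding F_def
      by (intro continuous_intros p_cont continuous_on_subset[OF v] indefinite_integral_continuous_1
            integrable_continuous_real h_cont) auto
    fix x assume x: "0 < x" "x < s"
    have "((\<lambda>x. integral {0..x} h) has_real_derivative h x) (at x within {0..s})"
      using integral_has_real_derivative[OF h_cont, of x] x by simp
    then have I: "((\<lambda>x. integral {0..x} h) has_real_derivative h x) (at x)"
      using x by (simp add: at_within_Icc_at)
    have P: "((\<lambda>\<eta>. (s - \<eta>) powr (-\<theta>)) has_real_derivative \<theta> * (s - x) powr (-\<theta>-1)) (at x)"
      using x by (auto intro!: derivative_eq_intros simp: powr_diff field_simps)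
    have W: "((\<lambda>\<eta>. v s - v \<eta>) has_real_derivative - g x) (at x)"
      using deriv[OF x] by (auto intro!: derivative_eq_intros)
    have "(F has_real_derivative h x + 1/2 * ((\<theta> * (s - x) powr (-\<theta>-1) * (v s - v x) +
         (- g x) * (s - x) powr (-\<theta>)) * (v s - v x) + (- g x) * ((s - x) powr (-\<theta>) * (v s - v x)))) (at x)"
      unfolding F_def p_def by (rule DERIV_add[OF I DERIV_cmult[OF DERIV_mult[OF DERIV_mult[OF P W] W]]])
    moreover have "h x + 1/2 * ((\<theta> * (s - x) powr (-\<theta>-1) * (v s - v x) +
         (- g x) * (s - x) powr (-\<theta>)) * (v s - v x) + (- g x) * ((s - x) powr (-\<theta>) * (v s - v x)))
       = 1/2 * (\<theta> * (s - x) powr (-\<theta>-1) * (v s - v x)\<^sup>2)"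
      by (simp add: h_def p_def algebra_simps power2_eq_square)
    ultimately have "(F has_real_derivative 1/2 * (\<theta> * (s - x) powr (-\<theta>-1) * (v s - v x)\<^sup>2)) (at x)"
      by (simp only:)
    then show "\<exists>y. (F has_real_derivative y) (at x) \<and> 0 \<le> y"
      using \<theta> by (intro exI conjI) auto
  qed
  moreover have "0 \<le> F 0"
    by (simp add: F_def p_def mult.assoc power2_eq_square[symmetric])
  moreover have "F s = integral {0..s} h"
    by (simp add: F_def)
  ultimately have nonneg: "0 \<le> integral {0..s} h" by simp
  have ig: "set_integrable lborel {0<..<s} (\<lambda>\<eta>. v s * ((s - \<eta>) powr (-\<theta>) * g \<eta>))"
    using abel_integrable(1)[of \<theta> g s M] M \<theta> by (cases "v s = 0", simp add: set_integrable_def, auto)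
  have ivg: "set_integrable lborel {0<..<s} (\<lambda>\<eta>. (s - \<eta>) powr (-\<theta>) * (v \<eta> * g \<eta>))"
    using abel_integrable(1)[of \<theta> "\<lambda>\<eta>. v \<eta> * g \<eta>" s M2] M2 \<theta> by auto
  have "v s * abel \<theta> g s - abel \<theta> (\<lambda>\<eta>. v \<eta> * g \<eta>) s
      = (LINT \<eta>:{0<..<s}|lborel. v s * ((s - \<eta>) powr (-\<theta>) * g \<eta>) - (s - \<eta>) powr (-\<theta>) * (v \<eta> * g \<eta>))"
    unfolding abel_def by (subst set_integral_diff(2)[OF ig ivg]) simp
  also have "\<dots> = integral {0<..<s} (\<lambda>\<eta>. v s * ((s - \<eta>) powr (-\<theta>) * g \<eta>) - (s - \<eta>) powr (-\<theta>) * (v \<eta> * g \<eta>))"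
    by (rule set_borel_integral_eq_integral(2)[OF set_integral_diff(1)[OF ig ivg]])
  also have "\<dots> = integral {0..s} h"
    by (simp only: integral_open_interval_real[symmetric])
       (rule Henstock_Kurzweil_Integration.integral_cong, simp add: h_def p_def algebra_simps)
  finally show ?thesis using nonneg by simp
qed

text \<open>Exchanging the integrations over the triangle 0 < \<eta> < s < t leaves the kernel (t -
  \<eta>)^(1 - \<theta>) / (1 - \<theta>), whose derivative in \<eta> is -(t - \<eta>)^(-\<theta>).
  Integration by parts therefore moves the derivative off \<open>w\<close> and restores the
  convolution of the same order, now at time t.\<close>

lemma abel_derivative_integral:
  fixes w g :: "real \<Rightarrow> real"
  assumes \<theta>: "\<theta> < 1" and t: "0 < t"
    and w: "continuous_on UNIV w" and g: "continuous_on UNIV g"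
    and deriv: "\<And>\<eta>. 0 < \<eta> \<Longrightarrow> \<eta> < t \<Longrightarrow> (w has_real_derivative g \<eta>) (at \<eta>)"
  shows "set_integrable lborel {0<..<t} (abel \<theta> g)"
    and "(LINT s:{0<..<t}|lborel. abel \<theta> g s) = abel \<theta> w t - w 0 * (t powr (1-\<theta>) / (1-\<theta>))"
proof -
  obtain M where M: "\<And>\<eta>. \<eta> \<in> {0..t} \<Longrightarrow> \<bar>g \<eta>\<bar> \<le> M"
    using continuous_on_Icc_bounded[OF g] by metis
  obtain N where N: "\<And>\<eta>. \<eta> \<in> {0..t} \<Longrightarrow> \<bar>w \<eta>\<bar> \<le> N"
    using continuous_on_Icc_bounded[OF w] by metis
  have gm [measurable]: "g \<in> borel_measurable borel" and wm [measurable]: "w \<in> borel_measurable borel"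
    using w g by (auto intro: borel_measurable_continuous_onI)
  \<comment> \<open>The integrand is extended by 0 from the triangle, so that both iterated
    integrals run over the whole line. One order of integration gives the smoothed kernel, the other
    the convolution \<open>abel \<theta> g s\<close>.\<close>
  define F where "F \<eta> s = (if 0 < \<eta> \<and> \<eta> < s \<and> s < t then (s - \<eta>) powr (-\<theta>) * g \<eta> else 0)" for \<eta> s :: real
  have Fm [measurable]: "case_prod F \<in> borel_measurable (lborel \<Otimes>\<^sub>M lborel)"
    unfolding F_def by measurable
  have F1: "has_bochner_integral lborel (F \<eta>) (indicator {0<..<t} \<eta> * (g \<eta> * ((t-\<eta>) powr (1-\<theta>) / (1-\<theta>))))" for \<eta>
  proof (cases "0 < \<eta> \<and> \<eta> < t")
    case True
    have "has_bochner_integral lborel (\<lambda>s. g \<eta> * (indicator {\<eta><..<t} s * (s-\<eta>) powr (-\<theta>))) (g \<eta> * ((t-\<eta>) powr (1-\<theta>) / (1-\<theta>)))"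
      using powr_kernel_left[of \<theta> \<eta> t] True \<theta> by (intro has_bochner_integral_mult_right) auto
    moreover have "(\<lambda>s. g \<eta> * (indicator {\<eta><..<t} s * (s-\<eta>) powr (-\<theta>))) = F \<eta>"
      using True by (auto simp: F_def fun_eq_iff)
    ultimately show ?thesis using True by simp
  next
    case False
    then have "F \<eta> = (\<lambda>_. 0)" by (auto simp: F_def fun_eq_iff)
    then show ?thesis using False by (auto simp: indicator_def)
  qed
  have F2: "(LINT s|lborel. norm (F \<eta> s)) = indicator {0<..<t} \<eta> * (\<bar>g \<eta>\<bar> * ((t-\<eta>) powr (1-\<theta>) / (1-\<theta>)))" for \<eta>
  proof (cases "0 < \<eta> \<and> \<eta> < t")
    case True
    have "has_bochner_integral lborel (\<lambda>s. \<bar>g \<eta>\<bar> * (indicator {\<eta><..<t} s * (s-\<eta>) powr (-\<theta>))) (\<bar>g \<eta>\<bar> * ((t-\<eta>) powr (1-\<theta>) / (1-\<theta>)))"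
      using powr_kernel_left[of \<theta> \<eta> t] True \<theta> by (intro has_bochner_integral_mult_right) auto
    moreover have "(\<lambda>s. \<bar>g \<eta>\<bar> * (indicator {\<eta><..<t} s * (s-\<eta>) powr (-\<theta>))) = (\<lambda>s. norm (F \<eta> s))"
      using True by (auto simp: F_def fun_eq_iff abs_mult)
    ultimately show ?thesis using True by (simp add: has_bochner_integral_iff)
  next
    case False
    then have "F \<eta> = (\<lambda>_. 0)" by (auto simp: F_def fun_eq_iff)
    then show ?thesis using False by (auto simp: indicator_def)
  qed
  \<comment> \<open>Once the singular kernel has been integrated in s, the exponent is positive and
    the remaining function of \<eta> is continuous on a compact interval. Absolute integrability
    over the triangle follows from this.\<close>
  have cL: "continuous_on {0..t} (\<lambda>\<eta>. (t-\<eta>) powr (1-\<theta>) / (1-\<theta>))"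
    using \<theta> by (intro continuous_intros continuous_on_powr') auto
  have int_gL: "set_integrable lborel {0..t} (\<lambda>\<eta>. \<bar>g \<eta>\<bar> * ((t-\<eta>) powr (1-\<theta>) / (1-\<theta>)))"
    by (intro borel_integrable_atLeastAtMost' continuous_intros cL continuous_on_subset[OF g]) auto
  have int_gL': "set_integrable lborel {0..t} (\<lambda>\<eta>. g \<eta> * ((t-\<eta>) powr (1-\<theta>) / (1-\<theta>)))"
    by (intro borel_integrable_atLeastAtMost' continuous_intros cL continuous_on_subset[OF g]) auto
  have int_F: "integrable (lborel \<Otimes>\<^sub>M lborel) (case_prod F)"
  proof (rule lborel_pair.Fubini_integrable)
    have "set_integrable lborel {0<..<t} (\<lambda>\<eta>. \<bar>g \<eta>\<bar> * ((t-\<eta>) powr (1-\<theta>) / (1-\<theta>)))"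
      by (rule set_integrable_subset[OF int_gL]) auto
    then show "integrable lborel (\<lambda>x. LINT y|lborel. norm (case (x, y) of (x, xa) \<Rightarrow> F x xa))"
      by (simp only: prod.case F2) (simp add: set_integrable_def)
    show "AE x in lborel. integrable lborel (\<lambda>y. case (x, y) of (x, xa) \<Rightarrow> F x xa)"
      using F1 by (auto simp: has_bochner_integral_iff)
  qed (rule Fm)
  have inner: "(LINT \<eta>|lborel. F \<eta> s) = indicator {0<..<t} s * abel \<theta> g s" for s
    unfolding abel_def set_lebesgue_integral_def
    by (subst integral_mult_right_zero[symmetric], rule Bochner_Integration.integral_cong)
       (auto simp: F_def indicator_def)
  show "set_integrable lborel {0<..<t} (abel \<theta> g)"
    using lborel_pair.integrable_snd[OF int_F] by (simp add: set_integrable_def inner)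
  have "(LINT s:{0<..<t}|lborel. abel \<theta> g s) = (LINT s|lborel. LINT \<eta>|lborel. F \<eta> s)"
    by (simp add: set_lebesgue_integral_def inner)
  also have "\<dots> = (LINT \<eta>|lborel. LINT s|lborel. F \<eta> s)"
    by (rule lborel_pair.Fubini_integral[OF int_F])
  also have "\<dots> = (LINT \<eta>:{0<..<t}|lborel. g \<eta> * ((t-\<eta>) powr (1-\<theta>) / (1-\<theta>)))"
    using F1 by (simp add: has_bochner_integral_iff set_lebesgue_integral_def)
  finally have L: "(LINT s:{0<..<t}|lborel. abel \<theta> g s) = (LINT \<eta>:{0<..<t}|lborel. g \<eta> * ((t-\<eta>) powr (1-\<theta>) / (1-\<theta>)))" .
  have i1: "set_integrable lborel {0<..<t} (\<lambda>\<eta>. g \<eta> * ((t-\<eta>) powr (1-\<theta>) / (1-\<theta>)))"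
    by (rule set_integrable_subset[OF int_gL']) auto
  have i2: "set_integrable lborel {0<..<t} (\<lambda>\<eta>. (t - \<eta>) powr (-\<theta>) * w \<eta>)"
    using abel_integrable(1)[of \<theta> w t N] N \<theta> by auto
  have "((\<lambda>\<eta>. g \<eta> * ((t-\<eta>) powr (1-\<theta>) / (1-\<theta>)) - (t - \<eta>) powr (-\<theta>) * w \<eta>) has_integral
      w t * ((t-t) powr (1-\<theta>) / (1-\<theta>)) - w 0 * ((t-0) powr (1-\<theta>) / (1-\<theta>))) {0..t}"
  \<comment> \<open>The derivative of \<open>w\<close> is known only at interior times, but the
    product is continuous up to both ends. At \<eta> = t it vanishes because 1 - \<theta> > 0, so
    only the initial value survives.\<close>
  proof (rule fundamental_theorem_of_calculus_interior[where f = "\<lambda>\<eta>. w \<eta> * ((t-\<eta>) powr (1-\<theta>) / (1-\<theta>))"])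
    show "continuous_on {0..t} (\<lambda>\<eta>. w \<eta> * ((t-\<eta>) powr (1-\<theta>) / (1-\<theta>)))"
      by (intro continuous_intros cL continuous_on_subset[OF w]) auto
    fix x assume x: "x \<in> {0<..<t}"
    have P: "((\<lambda>\<eta>. (t-\<eta>) powr (1-\<theta>) / (1-\<theta>)) has_real_derivative - ((t - x) powr (-\<theta>))) (at x)"
    proof -
      have "((\<lambda>\<eta>. (t-\<eta>) powr (1-\<theta>)) has_real_derivative (1-\<theta>) * - ((t - x) powr (-\<theta>))) (at x)"
        using x by (auto intro!: derivative_eq_intros)
      from DERIV_cdivide[OF this, of "1-\<theta>"] show ?thesis using \<theta> by simp
    qed
    have "((\<lambda>\<eta>. w \<eta> * ((t-\<eta>) powr (1-\<theta>) / (1-\<theta>))) has_real_derivative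
         g x * ((t-x) powr (1-\<theta>) / (1-\<theta>)) - (t - x) powr (-\<theta>) * w x) (at x)"
      using DERIV_mult[OF deriv P] x by (simp add: algebra_simps)
    then show "((\<lambda>\<eta>. w \<eta> * ((t-\<eta>) powr (1-\<theta>) / (1-\<theta>))) has_vector_derivative
         g x * ((t-x) powr (1-\<theta>) / (1-\<theta>)) - (t - x) powr (-\<theta>) * w x) (at x)"
      by (simp add: has_real_derivative_iff_has_vector_derivative)
  qed (use t in simp)
  then have "integral {0<..<t} (\<lambda>\<eta>. g \<eta> * ((t-\<eta>) powr (1-\<theta>) / (1-\<theta>)) - (t - \<eta>) powr (-\<theta>) * w \<eta>)
      = - (w 0 * (t powr (1-\<theta>) / (1-\<theta>)))"
    by (simp only: integral_open_interval_real[symmetric]) (simp add: integral_unique)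
  then have "(LINT \<eta>:{0<..<t}|lborel. g \<eta> * ((t-\<eta>) powr (1-\<theta>) / (1-\<theta>)) - (t - \<eta>) powr (-\<theta>) * w \<eta>)
      = - (w 0 * (t powr (1-\<theta>) / (1-\<theta>)))"
    using set_borel_integral_eq_integral(2)[OF set_integral_diff(1)[OF i1 i2]] by simp
  then show "(LINT s:{0<..<t}|lborel. abel \<theta> g s) = abel \<theta> w t - w 0 * (t powr (1-\<theta>) / (1-\<theta>))"
    unfolding L set_integral_diff(2)[OF i1 i2] abel_def[of \<theta> w] by simp
qed

section \<open>Integration over the order parameter\<close>

text \<open>The weights are Lebesgue but possibly not Borel measurable in the order parameter, so
  Fubini's theorem needs \<open>lebesgue\<close> as one factor. A countable Borel cover by sets of
  finite measure survives completion.\<close>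

lemma sigma_finite_lebesgue: "sigma_finite_measure (lebesgue :: 'a::euclidean_space measure)"
proof
  obtain A :: "'a set set" where A: "countable A" "A \<subseteq> sets lborel" "\<Union>A = space lborel"
    "\<forall>a\<in>A. emeasure lborel a \<noteq> \<infinity>"
    using lborel.sigma_finite_countable by blast
  then show "\<exists>A. countable A \<and> A \<subseteq> sets (lebesgue :: 'a measure) \<and> \<Union>A = space lebesgue \<and>
      (\<forall>a\<in>A. emeasure lebesgue a \<noteq> \<infinity>)"
    by (intro exI[of _ A]) auto
qed

interpretation lebesgue_lborel: pair_sigma_finite "lebesgue :: real measure" "lborel :: real measure"
  by (intro pair_sigma_finite.intro sigma_finite_lebesgue sigma_finite_lborel)

lemma set_integrable_weight_mult:
  fixes w f :: "'a \<Rightarrow> real"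
  assumes w: "set_integrable M A w" and f: "f \<in> borel_measurable M"
    and M: "\<And>x. x \<in> A \<Longrightarrow> \<bar>f x\<bar> \<le> N"
  shows "set_integrable M A (\<lambda>x. w x * f x)"
  unfolding set_integrable_def
proof (rule Bochner_Integration.integrable_bound)
  show "integrable M (\<lambda>x. N * norm (indicator A x *\<^sub>R w x))"
    using w by (intro integrable_mult_right integrable_norm) (simp add: set_integrable_def)
  \<comment> \<open>Set integrability gives measurability of \<open>w\<close> only after
    multiplication by the indicator of \<open>A\<close>, so the indicator is grouped with
    \<open>w\<close> before multiplying by \<open>f\<close>.\<close>
  have "(\<lambda>x. (indicator A x *\<^sub>R w x) * f x) \<in> borel_measurable M"
    using f w by (intro borel_measurable_times) (auto simp: set_integrable_def)
  then show "(\<lambda>x. indicator A x *\<^sub>R (w x * f x)) \<in> borel_measurable M"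
    by (simp add: mult.assoc)
  show "AE x in M. norm (indicator A x *\<^sub>R (w x * f x)) \<le> norm (N * norm (indicator A x *\<^sub>R w x))"
  proof (rule AE_I2)
    fix x
    have "\<bar>w x\<bar> * \<bar>f x\<bar> \<le> \<bar>N\<bar> * \<bar>w x\<bar>" if "x \<in> A"
      using mult_right_mono[OF order_trans[OF M[OF that] abs_ge_self], of "\<bar>w x\<bar>"] by (simp add: mult.commute)
    then show "norm (indicator A x *\<^sub>R (w x * f x)) \<le> norm (N * norm (indicator A x *\<^sub>R w x))"
      by (auto simp: indicator_def abs_mult)
  qed
qed

text \<open>On \<open>A\<close> times a bounded time interval the integrand is dominated by
  \<open>N\<close> times the modulus of the weight, a product of integrable functions of one
  variable each. The order variable carries \<open>lebesgue\<close> for the sake of the weight,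
  while time can stay Borel.\<close>

lemma weighted_Fubini:
  fixes w :: "real \<Rightarrow> real" and D :: "real \<Rightarrow> real \<Rightarrow> real"
  assumes w: "set_integrable lebesgue A w"
    and D [measurable]: "case_prod D \<in> borel_measurable (lebesgue \<Otimes>\<^sub>M lborel)"
    and bound: "\<And>\<gamma> s. \<gamma> \<in> A \<Longrightarrow> 0 < s \<Longrightarrow> s < t \<Longrightarrow> \<bar>D \<gamma> s\<bar> \<le> N"
  shows "set_integrable lborel {0<..<t} (\<lambda>s. LINT \<gamma>:A|lebesgue. w \<gamma> * D \<gamma> s)"
    and "set_integrable lebesgue A (\<lambda>\<gamma>. w \<gamma> * (LINT s:{0<..<t}|lborel. D \<gamma> s))"
    and "(LINT s:{0<..<t}|lborel. LINT \<gamma>:A|lebesgue. w \<gamma> * D \<gamma> s)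
       = (LINT \<gamma>:A|lebesgue. w \<gamma> * (LINT s:{0<..<t}|lborel. D \<gamma> s))"
proof -
  define W where "W \<gamma> = indicator A \<gamma> * w \<gamma>" for \<gamma>
  have W: "integrable lebesgue W"
    using w by (simp add: set_integrable_def W_def[abs_def])
  have Wm [measurable]: "W \<in> borel_measurable lebesgue" using W by auto
  define F where "F \<gamma> s = W \<gamma> * (indicator {0<..<t} s * D \<gamma> s)" for \<gamma> s
  define G where "G = (\<lambda>(\<gamma>, s). W \<gamma> * (indicator {0<..<t} s * N))"
  have Fm: "case_prod F \<in> borel_measurable (lebesgue \<Otimes>\<^sub>M lborel)"
    unfolding F_def by measurable
  have iN: "integrable lborel (\<lambda>s. indicator {0<..<t} s * N)"
    by (intro integrable_mult_left integrable_real_indicator emeasure_bounded_finite) auto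
  have G: "integrable (lebesgue \<Otimes>\<^sub>M lborel) G"
  proof (rule lebesgue_lborel.Fubini_integrable)
    show "G \<in> borel_measurable (lebesgue \<Otimes>\<^sub>M lborel)" unfolding G_def by measurable
    show "integrable lebesgue (\<lambda>x. LINT y|lborel. norm (G (x, y)))"
      using W by (auto simp: G_def abs_mult)
    show "AE x in lebesgue. integrable lborel (\<lambda>y. G (x, y))"
      using iN by (auto simp: G_def)
  qed
  have F: "integrable (lebesgue \<Otimes>\<^sub>M lborel) (case_prod F)"
  proof (rule Bochner_Integration.integrable_bound[OF G Fm])
    show "AE x in lebesgue \<Otimes>\<^sub>M lborel. norm (case x of (x, xa) \<Rightarrow> F x xa) \<le> norm (G x)"
      by (intro AE_I2)
         (auto simp: F_def G_def W_def abs_mult indicator_def intro!: mult_left_mono order_trans[OF bound abs_ge_self])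
  qed
  have e1: "(LINT \<gamma>|lebesgue. F \<gamma> s) = indicator {0<..<t} s * (LINT \<gamma>:A|lebesgue. w \<gamma> * D \<gamma> s)" for s
    unfolding set_lebesgue_integral_def
    by (subst integral_mult_right_zero[symmetric], rule Bochner_Integration.integral_cong)
       (auto simp: F_def W_def)
  have e2: "(LINT s|lborel. F \<gamma> s) = indicator A \<gamma> * (w \<gamma> * (LINT s:{0<..<t}|lborel. D \<gamma> s))" for \<gamma>
    unfolding set_lebesgue_integral_def
    by (simp add: F_def W_def)
  show "set_integrable lborel {0<..<t} (\<lambda>s. LINT \<gamma>:A|lebesgue. w \<gamma> * D \<gamma> s)"
    using lebesgue_lborel.integrable_snd[OF F] by (simp add: set_integrable_def e1)
  show "set_integrable lebesgue A (\<lambda>\<gamma>. w \<gamma> * (LINT s:{0<..<t}|lborel. D \<gamma> s))"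
    using lebesgue_lborel.integrable_fst[OF F] by (simp add: set_integrable_def e2)
  show "(LINT s:{0<..<t}|lborel. LINT \<gamma>:A|lebesgue. w \<gamma> * D \<gamma> s)
       = (LINT \<gamma>:A|lebesgue. w \<gamma> * (LINT s:{0<..<t}|lborel. D \<gamma> s))"
    using lebesgue_lborel.Fubini_integral[OF F]
    by (simp add: set_lebesgue_integral_def[of lborel "{0<..<t}" "\<lambda>s. LINT \<gamma>:A|lebesgue. w \<gamma> * D \<gamma> s"]
        set_lebesgue_integral_def[of lebesgue A "\<lambda>\<gamma>. w \<gamma> * (LINT s:{0<..<t}|lborel. D \<gamma> s)"] e1 e2)
qed

text \<open>The kernel has mass s^(1 - \<theta>) / (1 - \<theta>), and \<open>rGamma (1 - \<theta>)
  = (1 - \<theta>) * rGamma (2 - \<theta>)\<close> cancels the denominator. Replacing s^(1 -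
  \<theta>) by 1 + s also removes the order from the exponent, so what is left is bounded as soon as
  \<open>rGamma (2 - \<theta>)\<close> is.\<close>

lemma rGamma_abel_bound:
  assumes "\<theta> < 1" "g \<in> borel_measurable borel" "\<And>\<eta>. 0 < \<eta> \<Longrightarrow> \<eta> < s \<Longrightarrow> \<bar>g \<eta>\<bar> \<le> M" "0 < s"
    "\<theta> > 0"
  shows "\<bar>rGamma (1 - \<theta>) * abel \<theta> g s\<bar> \<le> \<bar>rGamma (2 - \<theta>)\<bar> * (\<bar>M\<bar> * (1 + s))"
proof -
  have s: "s powr (1-\<theta>) \<le> 1 + s"
  proof (cases "s \<le> 1")
    case True
    then show ?thesis using powr_mono2[of "1-\<theta>" s 1] assms by simp
  next
    case False
    then show ?thesis using powr_mono[of "1-\<theta>" 1 s] assms by simp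
  qed
  have g: "rGamma (1 - \<theta>) = (1-\<theta>) * rGamma (2 - \<theta>)"
    using rGamma_plus1[of "1-\<theta>"] by (simp add: algebra_simps)
  have "\<bar>abel \<theta> g s\<bar> \<le> \<bar>M\<bar> * (s powr (1-\<theta>) / (1-\<theta>))"
    using abel_integrable(2)[of \<theta> g s "\<bar>M\<bar>"] assms by force
  then have "\<bar>rGamma (1 - \<theta>) * abel \<theta> g s\<bar> \<le> \<bar>rGamma (1 - \<theta>)\<bar> * (\<bar>M\<bar> * (s powr (1-\<theta>) / (1-\<theta>)))"
    unfolding abs_mult by (intro mult_left_mono) auto
  also have "\<dots> = \<bar>rGamma (2 - \<theta>)\<bar> * (\<bar>M\<bar> * s powr (1-\<theta>))"
    using assms by (simp add: g abs_mult)
  also have "\<dots> \<le> \<bar>rGamma (2 - \<theta>)\<bar> * (\<bar>M\<bar> * (1 + s))"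
    using s by (intro mult_left_mono) auto
  finally show ?thesis .
qed

text \<open>For a fixed order the inequality holds at each time and is integrated over time first;
  nonnegativity of the weight then allows integration over the order, and Fubini's theorem restores
  the order of integration of the equation. The integrability claims keep the splitting of integrals
  into sums and differences legitimate, here and when several weights are added.\<close>

lemma distributed_order_energy:
  fixes \<theta> w v g :: "real \<Rightarrow> real"
  assumes \<theta>: "continuous_on UNIV \<theta>" "\<And>\<gamma>. 0 < \<theta> \<gamma>" "\<And>\<gamma>. \<theta> \<gamma> < 1"
    and w: "set_integrable lebesgue {a..b} w" "\<And>\<gamma>. \<gamma> \<in> {a..b} \<Longrightarrow> 0 \<le> w \<gamma>"
    and t: "0 < t"
    and v: "continuous_on UNIV v" and g: "continuous_on UNIV g"
    and deriv: "\<And>\<eta>. 0 < \<eta> \<Longrightarrow> \<eta> < t \<Longrightarrow> (v has_real_derivative g \<eta>) (at \<eta>)"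
  shows "\<And>s. 0 < s \<Longrightarrow> s \<le> t \<Longrightarrow>
        set_integrable lebesgue {a..b} (\<lambda>\<gamma>. w \<gamma> * (rGamma (1 - \<theta> \<gamma>) * abel (\<theta> \<gamma>) g s))"
    and "set_integrable lebesgue {a..b} (\<lambda>\<gamma>. w \<gamma> * (rGamma (1 - \<theta> \<gamma>) * abel (\<theta> \<gamma>) (\<lambda>\<eta>. (v \<eta>)\<^sup>2) t))"
    and "set_integrable lebesgue {a..b} (\<lambda>\<gamma>. w \<gamma> * (t powr (1 - \<theta> \<gamma>) * rGamma (2 - \<theta> \<gamma>)))"
    and "set_integrable lborel {0<..<t}
         (\<lambda>s. v s * (LINT \<gamma>:{a..b}|lebesgue. w \<gamma> * (rGamma (1 - \<theta> \<gamma>) * abel (\<theta> \<gamma>) g s)))"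
    and "1/2 * ((LINT \<gamma>:{a..b}|lebesgue. w \<gamma> * (rGamma (1 - \<theta> \<gamma>) * abel (\<theta> \<gamma>) (\<lambda>\<eta>. (v \<eta>)\<^sup>2) t))
           - (v 0)\<^sup>2 * (LINT \<gamma>:{a..b}|lebesgue. w \<gamma> * (t powr (1 - \<theta> \<gamma>) * rGamma (2 - \<theta> \<gamma>))))
       \<le> (LINT s:{0<..<t}|lborel. v s * (LINT \<gamma>:{a..b}|lebesgue. w \<gamma> * (rGamma (1 - \<theta> \<gamma>) * abel (\<theta> \<gamma>) g s)))"
proof -
  obtain M where M: "\<And>\<eta>. \<eta> \<in> {0..t} \<Longrightarrow> \<bar>g \<eta>\<bar> \<le> M"
    using continuous_on_Icc_bounded[OF g] by metis
  obtain N where N: "\<And>\<eta>. \<eta> \<in> {0..t} \<Longrightarrow> \<bar>v \<eta>\<bar> \<le> N"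
    using continuous_on_Icc_bounded[OF v] by metis
  have v2: "continuous_on UNIV (\<lambda>\<eta>. (v \<eta>)\<^sup>2)"
    by (intro continuous_intros v)
  obtain N2 where N2: "\<And>\<eta>. \<eta> \<in> {0..t} \<Longrightarrow> \<bar>(v \<eta>)\<^sup>2\<bar> \<le> N2"
    using continuous_on_Icc_bounded[OF v2] by metis
  have vg: "continuous_on UNIV (\<lambda>\<eta>. v \<eta> * g \<eta>)"
    by (intro continuous_intros v g)
  have "continuous_on UNIV (\<lambda>\<gamma>. rGamma (2 - \<theta> \<gamma>))"
    by (intro continuous_intros continuous_on_compose2[OF continuous_on_rGamma[of UNIV]] \<theta>) auto
  then obtain B where B: "\<And>\<gamma>. \<gamma> \<in> {a..b} \<Longrightarrow> \<bar>rGamma (2 - \<theta> \<gamma>)\<bar> \<le> B"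
    by (rule continuous_on_Icc_bounded) blast
  have M0: "0 \<le> M" and N0: "0 \<le> N"
    using M[of 0] N[of 0] t by auto
  have \<theta>b [measurable]: "\<theta> \<in> borel_measurable borel" and [measurable]: "v \<in> borel_measurable borel" "g \<in> borel_measurable borel"
    using v g \<theta> by (auto intro: borel_measurable_continuous_onI)
  have rGb [measurable]: "(rGamma :: real \<Rightarrow> real) \<in> borel_measurable borel"
    by (intro borel_measurable_continuous_onI continuous_on_rGamma)
  have \<theta>l [measurable]: "\<theta> \<in> borel_measurable lebesgue"
    using \<theta>b by (simp add: measurable_completion)
  have ab: "(\<lambda>\<gamma>. rGamma (1 - \<theta> \<gamma>) * abel (\<theta> \<gamma>) h s) \<in> borel_measurable lebesgue"
    if [measurable]: "h \<in> borel_measurable borel" for h s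
    by (intro borel_measurable_times measurable_abel) measurable
  have bd: "\<bar>rGamma (1 - \<theta> \<gamma>) * abel (\<theta> \<gamma>) h s\<bar> \<le> B * (K * (1 + t))"
    if "h \<in> borel_measurable borel" "\<And>\<eta>. \<eta> \<in> {0..t} \<Longrightarrow> \<bar>h \<eta>\<bar> \<le> K" "0 < s" "s \<le> t" "\<gamma> \<in> {a..b}" for h s K \<gamma>
  proof -
    have "0 \<le> K" using that(2)[of 0] t by auto
    have "\<bar>rGamma (1 - \<theta> \<gamma>) * abel (\<theta> \<gamma>) h s\<bar> \<le> \<bar>rGamma (2 - \<theta> \<gamma>)\<bar> * (\<bar>K\<bar> * (1 + s))"
      using that \<theta> by (intro rGamma_abel_bound) auto
    also have "\<dots> \<le> B * (K * (1 + t))"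
      using B[OF that(5)] that(3,4) \<open>0 \<le> K\<close> by (intro mult_mono) auto
    finally show ?thesis .
  qed
  show "set_integrable lebesgue {a..b} (\<lambda>\<gamma>. w \<gamma> * (rGamma (1 - \<theta> \<gamma>) * abel (\<theta> \<gamma>) g s))"
    if "0 < s" "s \<le> t" for s
    using bd[of g M s] that M by (intro set_integrable_weight_mult[OF w(1) ab]) auto
  show i2: "set_integrable lebesgue {a..b} (\<lambda>\<gamma>. w \<gamma> * (rGamma (1 - \<theta> \<gamma>) * abel (\<theta> \<gamma>) (\<lambda>\<eta>. (v \<eta>)\<^sup>2) t))"
    using bd[of "\<lambda>\<eta>. (v \<eta>)\<^sup>2" N2 t] N2 t by (intro set_integrable_weight_mult[OF w(1) ab]) auto
  have "continuous_on UNIV (\<lambda>\<gamma>. t powr (1 - \<theta> \<gamma>) * rGamma (2 - \<theta> \<gamma>))"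
    using t by (intro continuous_intros continuous_on_compose2[OF continuous_on_rGamma[of UNIV]] \<theta>) auto
  then obtain B2 where B2: "\<And>\<gamma>. \<gamma> \<in> {a..b} \<Longrightarrow> \<bar>t powr (1 - \<theta> \<gamma>) * rGamma (2 - \<theta> \<gamma>)\<bar> \<le> B2"
    by (rule continuous_on_Icc_bounded) blast
  show i3: "set_integrable lebesgue {a..b} (\<lambda>\<gamma>. w \<gamma> * (t powr (1 - \<theta> \<gamma>) * rGamma (2 - \<theta> \<gamma>)))"
    by (rule set_integrable_weight_mult[OF w(1) _ B2]) measurable
  \<comment> \<open>The factor \<open>v s\<close> is taken inside the integral over the order, so
    that \<open>D\<close> is bounded and Fubini's theorem can exchange the two integrals.\<close>
  define D where "D \<gamma> s = v s * (rGamma (1 - \<theta> \<gamma>) * abel (\<theta> \<gamma>) g s)" for \<gamma> s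
  have Dm: "case_prod D \<in> borel_measurable (lebesgue \<Otimes>\<^sub>M lborel)"
    unfolding D_def split_beta' by (intro borel_measurable_times measurable_abel) measurable
  have D_bd: "\<bar>D \<gamma> s\<bar> \<le> N * (B * (M * (1 + t)))" if "\<gamma> \<in> {a..b}" "0 < s" "s < t" for \<gamma> s
    unfolding D_def abs_mult[of "v s"] using bd[of g M s \<gamma>] N[of s] M N0 that by (intro mult_mono) auto
  note Fub = weighted_Fubini[OF w(1) Dm D_bd, simplified]
  have pull: "(LINT \<gamma>:{a..b}|lebesgue. w \<gamma> * D \<gamma> s)
     = v s * (LINT \<gamma>:{a..b}|lebesgue. w \<gamma> * (rGamma (1 - \<theta> \<gamma>) * abel (\<theta> \<gamma>) g s))" for s
    unfolding set_integral_mult_right[symmetric] D_def by (simp add: mult_ac)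
  show "set_integrable lborel {0<..<t}
         (\<lambda>s. v s * (LINT \<gamma>:{a..b}|lebesgue. w \<gamma> * (rGamma (1 - \<theta> \<gamma>) * abel (\<theta> \<gamma>) g s)))"
    using Fub(1) by (simp add: pull)
  have pointwise: "1/2 * (rGamma (1 - \<theta> \<gamma>) * abel (\<theta> \<gamma>) (\<lambda>\<eta>. (v \<eta>)\<^sup>2) t
        - (v 0)\<^sup>2 * (t powr (1 - \<theta> \<gamma>) * rGamma (2 - \<theta> \<gamma>))) \<le> (LINT s:{0<..<t}|lborel. D \<gamma> s)"
    if \<gamma>: "\<gamma> \<in> {a..b}" for \<gamma>
  proof -
    \<comment> \<open>The time-integral formula is applied to v^2 / 2, whose derivative v v' is
      exactly what Alikhanov's inequality has on its smaller side. This is the source of the factor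
      1/2 in the conclusion.\<close>
    have d2: "((\<lambda>\<eta>. 1/2 * (v \<eta>)\<^sup>2) has_real_derivative v \<eta> * g \<eta>) (at \<eta>)" if "0 < \<eta>" "\<eta> < t" for \<eta>
      using deriv[OF that] by (auto intro!: derivative_eq_intros)
    note I = abel_derivative_integral[OF \<theta>(3)[of \<gamma>] t _ vg d2]
    have c: "continuous_on UNIV (\<lambda>\<eta>. 1/2 * (v \<eta>)\<^sup>2)" by (intro continuous_intros v)
    have half: "abel (\<theta> \<gamma>) (\<lambda>\<eta>. 1/2 * (v \<eta>)\<^sup>2) t = 1/2 * abel (\<theta> \<gamma>) (\<lambda>\<eta>. (v \<eta>)\<^sup>2) t"
      unfolding abel_def by (subst set_integral_mult_right[symmetric]) (simp add: mult_ac)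
    have r0: "0 \<le> rGamma (1 - \<theta> \<gamma>)"
      using \<theta>(3)[of \<gamma>] by (simp add: rGamma_inverse_Gamma less_imp_le)
    have rg: "rGamma (1 - \<theta> \<gamma>) = (1-\<theta> \<gamma>) * rGamma (2 - \<theta> \<gamma>)"
      using rGamma_plus1[of "1-\<theta> \<gamma>"] by (simp add: algebra_simps)
    have i: "set_integrable lborel {0<..<t} (D \<gamma>)"
    proof (rule set_integrable_bound[where f = "\<lambda>_. N * (B * (M * (1 + t)))"])
      show "set_integrable lborel {0<..<t} (\<lambda>_. N * (B * (M * (1 + t))))"
        by (rule set_integrable_subset[of _ "{0..t}"]) (auto intro!: borel_integrable_atLeastAtMost')
      have "D \<gamma> \<in> borel_measurable lborel"
        unfolding D_def by (intro borel_measurable_times measurable_abel) measurable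
      then show "set_borel_measurable lborel {0<..<t} (D \<gamma>)"
        by (simp add: set_borel_measurable_def)
      show "AE x in lborel. x \<in> {0<..<t} \<longrightarrow> norm (D \<gamma> x) \<le> norm (N * (B * (M * (1 + t))))"
        using D_bd[OF \<gamma>] by (auto intro!: AE_I2 order_trans[OF _ abs_ge_self])
    qed
    have i': "set_integrable lborel {0<..<t} (\<lambda>s. rGamma (1 - \<theta> \<gamma>) * abel (\<theta> \<gamma>) (\<lambda>\<eta>. v \<eta> * g \<eta>) s)"
      using I(1)[OF c] by (cases "rGamma (1 - \<theta> \<gamma>) = 0", simp add: set_integrable_def, auto)
    have "1/2 * (rGamma (1 - \<theta> \<gamma>) * abel (\<theta> \<gamma>) (\<lambda>\<eta>. (v \<eta>)\<^sup>2) t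
        - (v 0)\<^sup>2 * (t powr (1 - \<theta> \<gamma>) * rGamma (2 - \<theta> \<gamma>)))
       = rGamma (1 - \<theta> \<gamma>) * (abel (\<theta> \<gamma>) (\<lambda>\<eta>. 1/2 * (v \<eta>)\<^sup>2) t - 1/2 * (v 0)\<^sup>2 * (t powr (1-\<theta> \<gamma>) / (1-\<theta> \<gamma>)))"
      using \<theta>(3)[of \<gamma>] unfolding half rg by (simp add: field_simps)
    also have "\<dots> = (LINT s:{0<..<t}|lborel. rGamma (1 - \<theta> \<gamma>) * abel (\<theta> \<gamma>) (\<lambda>\<eta>. v \<eta> * g \<eta>) s)"
      using I(2)[OF c] by simp
    also have "\<dots> \<le> (LINT s:{0<..<t}|lborel. D \<gamma> s)"
    proof (rule set_integral_mono[OF i' i])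
      fix s assume s: "s \<in> {0<..<t}"
      have "abel (\<theta> \<gamma>) (\<lambda>\<eta>. v \<eta> * g \<eta>) s \<le> v s * abel (\<theta> \<gamma>) g s"
        using s deriv by (intro abel_Alikhanov \<theta> v g) auto
      from mult_left_mono[OF this r0]
      show "rGamma (1 - \<theta> \<gamma>) * abel (\<theta> \<gamma>) (\<lambda>\<eta>. v \<eta> * g \<eta>) s \<le> D \<gamma> s"
        by (simp add: D_def mult_ac)
    qed
    finally show ?thesis .
  qed
  have i3': "set_integrable lebesgue {a..b} (\<lambda>\<gamma>. (v 0)\<^sup>2 * (w \<gamma> * (t powr (1 - \<theta> \<gamma>) * rGamma (2 - \<theta> \<gamma>))))"
    using i3 by (cases "v 0 = 0", simp add: set_integrable_def, auto)
  have "1/2 * ((LINT \<gamma>:{a..b}|lebesgue. w \<gamma> * (rGamma (1 - \<theta> \<gamma>) * abel (\<theta> \<gamma>) (\<lambda>\<eta>. (v \<eta>)\<^sup>2) t))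
           - (v 0)\<^sup>2 * (LINT \<gamma>:{a..b}|lebesgue. w \<gamma> * (t powr (1 - \<theta> \<gamma>) * rGamma (2 - \<theta> \<gamma>))))
     = (LINT \<gamma>:{a..b}|lebesgue. 1/2 * (w \<gamma> * (rGamma (1 - \<theta> \<gamma>) * abel (\<theta> \<gamma>) (\<lambda>\<eta>. (v \<eta>)\<^sup>2) t)
           - (v 0)\<^sup>2 * (w \<gamma> * (t powr (1 - \<theta> \<gamma>) * rGamma (2 - \<theta> \<gamma>)))))"
    unfolding set_integral_mult_right set_integral_diff(2)[OF i2 i3'] by simp
  also have "\<dots> \<le> (LINT \<gamma>:{a..b}|lebesgue. w \<gamma> * (LINT s:{0<..<t}|lborel. D \<gamma> s))"
  proof (rule set_integral_mono)
    show "set_integrable lebesgue {a..b} (\<lambda>\<gamma>. 1/2 * (w \<gamma> * (rGamma (1 - \<theta> \<gamma>) * abel (\<theta> \<gamma>) (\<lambda>\<eta>. (v \<eta>)\<^sup>2) t)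
           - (v 0)\<^sup>2 * (w \<gamma> * (t powr (1 - \<theta> \<gamma>) * rGamma (2 - \<theta> \<gamma>)))))"
      by (intro set_integrable_mult_right set_integral_diff(1)[OF i2 i3'])
    show "set_integrable lebesgue {a..b} (\<lambda>\<gamma>. w \<gamma> * (LINT s:{0<..<t}|lborel. D \<gamma> s))"
      by (rule Fub(2))
    fix \<gamma> assume "\<gamma> \<in> {a..b}"
    from mult_left_mono[OF pointwise[OF this] w(2)[OF this]]
    show "1/2 * (w \<gamma> * (rGamma (1 - \<theta> \<gamma>) * abel (\<theta> \<gamma>) (\<lambda>\<eta>. (v \<eta>)\<^sup>2) t)
           - (v 0)\<^sup>2 * (w \<gamma> * (t powr (1 - \<theta> \<gamma>) * rGamma (2 - \<theta> \<gamma>)))) \<le> w \<gamma> * (LINT s:{0<..<t}|lborel. D \<gamma> s)"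
      by (simp add: algebra_simps)
  qed
  finally show "1/2 * ((LINT \<gamma>:{a..b}|lebesgue. w \<gamma> * (rGamma (1 - \<theta> \<gamma>) * abel (\<theta> \<gamma>) (\<lambda>\<eta>. (v \<eta>)\<^sup>2) t))
           - (v 0)\<^sup>2 * (LINT \<gamma>:{a..b}|lebesgue. w \<gamma> * (t powr (1 - \<theta> \<gamma>) * rGamma (2 - \<theta> \<gamma>))))
       \<le> (LINT s:{0<..<t}|lborel. v s * (LINT \<gamma>:{a..b}|lebesgue. w \<gamma> * (rGamma (1 - \<theta> \<gamma>) * abel (\<theta> \<gamma>) g s)))"
    using Fub(3) unfolding pull by simp
qed

text \<open>Lebesgue measure on the plane is only the completion of the product measure, so Fubini's
  theorem has to be applied to a Borel representative.\<close>

lemma section_integral_integrable: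
  fixes F :: "real \<Rightarrow> real \<Rightarrow> real"
  assumes F: "set_integrable lebesgue (A \<times> B) (\<lambda>(x, y). F x y)"
    and sections: "\<And>x. x \<in> A \<Longrightarrow> set_integrable lebesgue B (F x)"
    and A [measurable]: "A \<in> sets borel"
  shows "set_integrable lebesgue A (\<lambda>x. LINT y:B|lebesgue. F x y)"
proof -
  define f where "f p = indicator (A \<times> B) p *\<^sub>R (case p of (x, y) \<Rightarrow> F x y)" for p
  have f: "integrable lebesgue f"
    using F by (simp add: set_integrable_def f_def[abs_def])
  then obtain f' where f' [measurable]: "f' \<in> borel_measurable lborel" and ae: "AE p in lborel. f p = f' p"
    using completion_ex_borel_measurable_real[of f lborel] by auto
  have f'l: "f' \<in> borel_measurable lebesgue"
    by (rule measurable_completion[OF f'])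
  have ae': "AE p in lebesgue. f p = f' p"
    using ae by (rule AE_completion)
  have "integrable lebesgue f'"
    using f by (rule integrable_cong_AE_imp[OF _ f'l]) (use ae' in \<open>auto simp: eq_commute\<close>)
  then have "integrable lborel f'"
    using f' by (simp add: integrable_completion)
  then have int: "integrable (lborel \<Otimes>\<^sub>M lborel) f'"
    by (simp add: lborel_prod)
  have i1: "integrable lborel (\<lambda>x. LINT y|lborel. f' (x, y))"
    by (rule lborel_pair.integrable_fst'[OF int])
  have f'm [measurable]: "f' \<in> borel_measurable (lborel \<Otimes>\<^sub>M lborel)"
    using f' by (simp add: lborel_prod)
  have "AE x in lborel. AE y in lborel. f (x, y) = f' (x, y)"
    using ae by (intro lborel_pair.AE_pair) (simp only: lborel_prod)
  \<comment> \<open>The Borel representative equals \<open>f\<close> only almost everywhere in the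
    plane, so the sections may disagree for x in a null set \<open>N\<close>. Altering the inner
    integral on \<open>N\<close> does not affect integrability in x.\<close>
  then obtain N where N: "N \<in> null_sets lborel" "{x. \<not> (AE y in lborel. f (x, y) = f' (x, y))} \<subseteq> N"
    by (auto simp: eventually_ae_filter)
  have "set_integrable lebesgue A (\<lambda>x. LINT y|lborel. f' (x, y))"
    unfolding set_integrable_def using i1 A
    by (intro integrable_mult_indicator) (auto simp: integrable_completion)
  then show ?thesis
  proof (rule absolutely_integrable_spike)
    show "negligible N"
      using N(1) by (auto simp: negligible_iff_null_sets intro: null_sets_completionI)
    fix x assume x: "x \<in> A - N"
    then have e: "AE y in lborel. f (x, y) = f' (x, y)" using N(2) by auto
    have fx: "(\<lambda>y. indicator B y *\<^sub>R F x y) = (\<lambda>y. f (x, y))"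
      using x by (auto simp: f_def indicator_def fun_eq_iff)
    \<comment> \<open>The comparison needs measurability of the section of \<open>F\<close> at this
      very x. Joint Lebesgue measurability would give it only for almost every x; the hypothesis
      \<open>sections\<close> gives it for all.\<close>
    have "(LINT y:B|lebesgue. F x y) = (LINT y|lebesgue. f' (x, y))"
      unfolding set_lebesgue_integral_def
    proof (rule integral_cong_AE)
      show "(\<lambda>y. indicator B y *\<^sub>R F x y) \<in> borel_measurable lebesgue"
        using sections x by (auto simp: set_integrable_def)
      show "(\<lambda>y. f' (x, y)) \<in> borel_measurable lebesgue"
        by (rule measurable_completion) measurable
      show "AE y in lebesgue. indicator B y *\<^sub>R F x y = f' (x, y)"
        using AE_completion[OF e] fx by (simp add: fun_eq_iff)
    qed
    also have "\<dots> = (LINT y|lborel. f' (x, y))"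
      by (rule integral_completion) measurable
    finally show "(LINT y:B|lebesgue. F x y) = (LINT y|lborel. f' (x, y))" .
  qed
qed

section \<open>Energy estimate in space\<close>

text \<open>The integral of (h - a)^2 about the mean value \<open>a\<close> is nonnegative; this is
  the Cauchy-Schwarz inequality against the constant 1.\<close>

lemma square_integral_le:
  fixes h :: "real \<Rightarrow> real"
  assumes h: "continuous_on {0..x} h" and x: "0 < x"
  shows "(integral {0..x} h)\<^sup>2 \<le> x * integral {0..x} (\<lambda>s. (h s)\<^sup>2)"
proof -
  define a where "a = integral {0..x} h / x"
  have i: "h integrable_on {0..x}" "(\<lambda>s. (h s)\<^sup>2) integrable_on {0..x}"
    by (intro integrable_continuous_real continuous_intros h)+
  have "((\<lambda>s. (h s)\<^sup>2 - 2 * a * h s + a\<^sup>2) has_integral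
      (integral {0..x} (\<lambda>s. (h s)\<^sup>2) - 2 * a * integral {0..x} h + a\<^sup>2 * x)) {0..x}"
    using x has_integral_const_real[of "a\<^sup>2" 0 x]
    by (intro has_integral_add has_integral_diff has_integral_mult_right integrable_integral i)
       (simp add: mult.commute)
  moreover have "(\<lambda>s. (h s)\<^sup>2 - 2 * a * h s + a\<^sup>2) = (\<lambda>s. (h s - a)\<^sup>2)"
    by (simp add: power2_diff fun_eq_iff algebra_simps)
  ultimately have "((\<lambda>s. (h s - a)\<^sup>2) has_integral
      (integral {0..x} (\<lambda>s. (h s)\<^sup>2) - 2 * a * integral {0..x} h + a\<^sup>2 * x)) {0..x}"
    by simp
  then have "0 \<le> integral {0..x} (\<lambda>s. (h s)\<^sup>2) - 2 * a * integral {0..x} h + a\<^sup>2 * x"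
    by (rule has_integral_nonneg) simp
  also have "\<dots> = integral {0..x} (\<lambda>s. (h s)\<^sup>2) - (integral {0..x} h)\<^sup>2 / x"
    using x by (simp add: a_def power2_eq_square)
  finally have "(integral {0..x} h)\<^sup>2 / x \<le> integral {0..x} (\<lambda>s. (h s)\<^sup>2)" by simp
  then show ?thesis using x by (simp add: pos_divide_le_eq mult.commute)
qed

text \<open>Since y(0) = 0, y(x) is the integral of y' from 0 to x, and Cauchy-Schwarz bounds y(x)^2
  by x times the full integral of y'^2. Integrating x over [0, l] produces the constant l^2 /
  2.\<close>

lemma Poincare_inequality:
  fixes y y' :: "real \<Rightarrow> real"
  assumes l: "0 < l" and y0: "y 0 = 0" and y': "continuous_on {0..l} y'"
    and d: "\<And>x. x \<in> {0..l} \<Longrightarrow> (y has_real_derivative y' x) (at x within {0..l})"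
  shows "integral {0..l} (\<lambda>x. (y x)\<^sup>2) \<le> l\<^sup>2 / 2 * integral {0..l} (\<lambda>x. (y' x)\<^sup>2)"
proof -
  have y: "continuous_on {0..l} y"
    by (rule DERIV_continuous_on[OF d])
  define Y where "Y = integral {0..l} (\<lambda>x. (y' x)\<^sup>2)"
  have i: "(\<lambda>s. (y' s)\<^sup>2) integrable_on {0..l}"
    by (intro integrable_continuous_real continuous_intros y')
  have le: "(y x)\<^sup>2 \<le> x * Y" if x: "x \<in> {0..l}" for x
  proof (cases "x = 0")
    case False
    have "(y' has_integral y x - y 0) {0..x}"
      using x by (intro fundamental_theorem_of_calculus)
        (auto simp: has_real_derivative_iff_has_vector_derivative[symmetric] intro!: DERIV_subset[OF d])
    then have "(y x)\<^sup>2 = (integral {0..x} y')\<^sup>2"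
      by (simp add: integral_unique y0)
    also have "\<dots> \<le> x * integral {0..x} (\<lambda>s. (y' s)\<^sup>2)"
      using x False by (intro square_integral_le continuous_on_subset[OF y']) auto
    also have "\<dots> \<le> x * Y"
      unfolding Y_def using x i
      by (intro mult_left_mono integral_subset_le integrable_on_subinterval[OF i]) auto
    finally show ?thesis .
  qed (simp add: y0)
  have "((\<lambda>x. x * Y) has_integral (l\<^sup>2 / 2 * Y - 0\<^sup>2 / 2 * Y)) {0..l}"
    using l by (intro fundamental_theorem_of_calculus)
      (auto simp: has_real_derivative_iff_has_vector_derivative[symmetric] intro!: derivative_eq_intros)
  then have I: "((\<lambda>x. x * Y) has_integral l\<^sup>2 / 2 * Y) {0..l}"
    by simp
  have "(\<lambda>x. (y x)\<^sup>2) integrable_on {0..l}"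
    by (intro integrable_continuous_real continuous_intros y)
  from has_integral_le[OF integrable_integral[OF this] I le] show ?thesis
    by (simp add: Y_def)
qed

lemma Dirichlet_energy_estimate:
  fixes y y' y'' \<kappa> \<kappa>' q f :: "real \<Rightarrow> real"
  assumes l: "0 < l" and c: "0 < c"
    and y0: "y 0 = 0" and yl: "y l = 0"
    and cont: "continuous_on {0..l} y'" "continuous_on {0..l} y''" "continuous_on {0..l} \<kappa>'"
       "continuous_on {0..l} q" "continuous_on {0..l} f"
    and dy: "\<And>x. x \<in> {0..l} \<Longrightarrow> (y has_real_derivative y' x) (at x within {0..l})"
    and dy': "\<And>x. x \<in> {0..l} \<Longrightarrow> (y' has_real_derivative y'' x) (at x within {0..l})"
    and d\<kappa>: "\<And>x. x \<in> {0..l} \<Longrightarrow> (\<kappa> has_real_derivative \<kappa>' x) (at x within {0..l})"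
    and \<kappa>: "\<And>x. x \<in> {0..l} \<Longrightarrow> c \<le> \<kappa> x"
    and q: "\<And>x. x \<in> {0..l} \<Longrightarrow> 0 \<le> q x"
  shows "integral {0..l} (\<lambda>x. y x * (\<kappa>' x * y' x + \<kappa> x * y'' x - q x * y x + f x))
       + c / 2 * integral {0..l} (\<lambda>x. (y' x)\<^sup>2)
      \<le> l\<^sup>2 / (4 * c) * integral {0..l} (\<lambda>x. (f x)\<^sup>2)"
proof -
  have cy: "continuous_on {0..l} y" by (rule DERIV_continuous_on[OF dy])
  have c\<kappa>: "continuous_on {0..l} \<kappa>" by (rule DERIV_continuous_on[OF d\<kappa>])
  \<comment> \<open>\<open>E\<close> is the derivative of y \<kappa> y', which vanishes at both
    ends. It equals \<kappa> y'^2 plus y times the expanded flux derivative, so its zero integral is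
    the integration by parts.\<close>
  define E where "E x = y' x * (\<kappa> x * y' x) + y x * (\<kappa>' x * y' x + \<kappa> x * y'' x)" for x
  have "(E has_integral (y l * (\<kappa> l * y' l) - y 0 * (\<kappa> 0 * y' 0))) {0..l}"
  proof (rule fundamental_theorem_of_calculus)
    fix x assume x: "x \<in> {0..l}"
    have "((\<lambda>x. y x * (\<kappa> x * y' x)) has_real_derivative E x) (at x within {0..l})"
      using DERIV_mult[OF dy[OF x] DERIV_mult[OF d\<kappa>[OF x] dy'[OF x]]]
      by (simp add: E_def algebra_simps)
    then show "((\<lambda>x. y x * (\<kappa> x * y' x)) has_vector_derivative E x) (at x within {0..l})"
      by (simp add: has_real_derivative_iff_has_vector_derivative)
  qed (use l in simp)
  then have E: "(E has_integral 0) {0..l}" by (simp add: y0 yl)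
  have i: "(\<lambda>x. (y' x)\<^sup>2) integrable_on {0..l}" "(\<lambda>x. (f x)\<^sup>2) integrable_on {0..l}"
    "(\<lambda>x. (y x)\<^sup>2) integrable_on {0..l}"
    "(\<lambda>x. y x * (\<kappa>' x * y' x + \<kappa> x * y'' x - q x * y x + f x)) integrable_on {0..l}"
    by (intro integrable_continuous_real continuous_intros cont cy c\<kappa>)+
  have "((\<lambda>x. E x - c * (y' x)\<^sup>2 + l\<^sup>2 / (4 * c) * (f x)\<^sup>2 + c / l\<^sup>2 * (y x)\<^sup>2) has_integral
     (0 - c * integral {0..l} (\<lambda>x. (y' x)\<^sup>2) + l\<^sup>2 / (4 * c) * integral {0..l} (\<lambda>x. (f x)\<^sup>2)
       + c / l\<^sup>2 * integral {0..l} (\<lambda>x. (y x)\<^sup>2))) {0..l}"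
    by (intro has_integral_add has_integral_diff has_integral_mult_right E integrable_integral i)
  then have "integral {0..l} (\<lambda>x. y x * (\<kappa>' x * y' x + \<kappa> x * y'' x - q x * y x + f x))
     \<le> 0 - c * integral {0..l} (\<lambda>x. (y' x)\<^sup>2) + l\<^sup>2 / (4 * c) * integral {0..l} (\<lambda>x. (f x)\<^sup>2)
       + c / l\<^sup>2 * integral {0..l} (\<lambda>x. (y x)\<^sup>2)"
  proof (rule has_integral_le[OF integrable_integral[OF i(4)]])
    fix x assume x: "x \<in> {0..l}"
    \<comment> \<open>Young's inequality in the form of a completed square, weighted so that the
      term in y^2 has coefficient c / l^2.\<close>
    have "0 \<le> (l\<^sup>2 * f x - 2 * c * y x)\<^sup>2 / (4 * c * l\<^sup>2)"
      using c by simp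
    also have "\<dots> = l\<^sup>2 / (4 * c) * (f x)\<^sup>2 + c / l\<^sup>2 * (y x)\<^sup>2 - f x * y x"
    proof -
      have expand: "(l\<^sup>2 * f x - 2 * c * y x)\<^sup>2 = l\<^sup>2 * (l\<^sup>2 * (f x)\<^sup>2) + 4 * c * (c * (y x)\<^sup>2) - (4 * c * l\<^sup>2) * (f x * y x)"
        by (simp add: power2_eq_square algebra_simps)
      have "(p * (p * A) + 4 * c * (c * B) - (4 * c * p) * C) / (4 * c * p) = p / (4 * c) * A + c / p * B - C"
        if "p \<noteq> 0" for p A B C :: real
        using that c by (simp add: field_simps)
      then show ?thesis unfolding expand using l by (metis power_not_zero less_irrefl)
    qed
    finally have "f x * y x \<le> l\<^sup>2 / (4 * c) * (f x)\<^sup>2 + c / l\<^sup>2 * (y x)\<^sup>2" by simp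
    moreover have "c * (y' x)\<^sup>2 \<le> \<kappa> x * (y' x)\<^sup>2"
      using \<kappa>[OF x] by (intro mult_right_mono) auto
    moreover have "0 \<le> q x * (y x)\<^sup>2"
      using q[OF x] by simp
    ultimately show "y x * (\<kappa>' x * y' x + \<kappa> x * y'' x - q x * y x + f x)
       \<le> E x - c * (y' x)\<^sup>2 + l\<^sup>2 / (4 * c) * (f x)\<^sup>2 + c / l\<^sup>2 * (y x)\<^sup>2"
      by (simp add: E_def algebra_simps power2_eq_square)
  qed
  moreover have "c / l\<^sup>2 * integral {0..l} (\<lambda>x. (y x)\<^sup>2) \<le> c / l\<^sup>2 * (l\<^sup>2 / 2 * integral {0..l} (\<lambda>x. (y' x)\<^sup>2))"
    using c by (intro mult_left_mono Poincare_inequality l y0 cont dy) auto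
  moreover have "c / l\<^sup>2 * (l\<^sup>2 / 2 * integral {0..l} (\<lambda>x. (y' x)\<^sup>2)) = c / 2 * integral {0..l} (\<lambda>x. (y' x)\<^sup>2)"
    using l by simp
  ultimately show ?thesis by simp
qed

section \<open>The a priori estimate\<close>

lemma continuous_on_clamp:
  fixes g :: "real \<Rightarrow> 'a::topological_space"
  assumes "continuous_on {a..b} g" "a \<le> b"
  shows "continuous_on UNIV (\<lambda>x. g (max a (min b x)))"
  using assms(2)
  by (intro continuous_on_compose2[OF assms(1)] continuous_intros) auto

lemma continuous_on_clamp2:
  fixes g :: "real \<Rightarrow> real \<Rightarrow> 'a::topological_space"
  assumes "continuous_on ({a..b} \<times> {c..d}) (\<lambda>(x, y). g x y)" "a \<le> b" "c \<le> d"
  shows "continuous_on UNIV (\<lambda>(x, y). g (max a (min b x)) (max c (min d y)))"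
proof -
  have "continuous_on UNIV (\<lambda>p. (max a (min b (fst p)), max c (min d (snd p))))"
    by (intro continuous_intros)
  from continuous_on_compose2[OF assms(1) this] show ?thesis
    using assms(2,3) by (simp add: split_beta' image_subset_iff)
qed

lemma set_lebesgue_integral_sum:
  fixes f :: "'i \<Rightarrow> 'a \<Rightarrow> real"
  assumes "\<And>i. i \<in> I \<Longrightarrow> set_integrable M A (f i)"
  shows "set_integrable M A (\<lambda>x. \<Sum>i\<in>I. f i x)"
    and "(LINT x:A|M. \<Sum>i\<in>I. f i x) = (\<Sum>i\<in>I. LINT x:A|M. f i x)"
  using assms unfolding set_integrable_def set_lebesgue_integral_def
  by (simp_all add: sum_distrib_left)

text \<open>Here x is a mere parameter: regularity is needed in time and in the order only. The sum
  over r leaves the integral over the order because every summand is integrable, which reduces the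
  claim to one weight and one order function at a time.\<close>

lemma P_caputo_energy:
  fixes u :: "real \<Rightarrow> real \<Rightarrow> real"
  assumes ab: "a < b"
    and \<theta>: "\<And>r. r \<in> {1..m} \<Longrightarrow> continuous_on {a..b} (\<theta> r x)"
      "\<And>r \<gamma>. r \<in> {1..m} \<Longrightarrow> \<gamma> \<in> {a..b} \<Longrightarrow> 0 < \<theta> r x \<gamma> \<and> \<theta> r x \<gamma> < 1"
    and \<omega>: "\<And>r. r \<in> {1..m} \<Longrightarrow> set_integrable lebesgue {a..b} (\<omega> r x)"
      "\<And>r \<gamma>. r \<in> {1..m} \<Longrightarrow> \<gamma> \<in> {a..b} \<Longrightarrow> 0 \<le> \<omega> r x \<gamma>"
    and t: "0 < t" "t \<le> T"
    and g: "continuous_on {0..T} g"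
    and deriv: "\<And>s. s \<in> {0..T} \<Longrightarrow> (u x has_real_derivative g s) (at s within {0..T})"
  shows "1/2 * (P_rl m a b \<omega> \<theta> (\<lambda>y s. (u y s)\<^sup>2) x t
           - (u x 0)\<^sup>2 * (LINT \<gamma>:{a..b}|lebesgue. \<Sum>r=1..m. \<omega> r x \<gamma> * t powr (1 - \<theta> r x \<gamma>) / Gamma (2 - \<theta> r x \<gamma>)))
       \<le> (LINT s:{0<..<t}|lborel. u x s * P_caputo m a b \<omega> \<theta> u x s)"
proof -
  \<comment> \<open>Composing with the projection onto the rectangle makes all data globally continuous,
    hence Borel measurable, without changing them where they matter.\<close>
  define cl where "cl s = max 0 (min T s)" for s :: real
  have cl: "cl s = s" if "0 \<le> s" "s \<le> T" for s using that by (simp add: cl_def)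
  define v where "v s = u x (cl s)" for s
  define h where "h s = g (cl s)" for s
  define \<tau> where "\<tau> r \<gamma> = \<theta> r x (max a (min b \<gamma>))" for r \<gamma>
  have \<tau>_eq: "\<tau> r \<gamma> = \<theta> r x \<gamma>" if "\<gamma> \<in> {a..b}" for r \<gamma>
    using that by (simp add: \<tau>_def)
  have v: "continuous_on UNIV v"
    unfolding v_def cl_def using t by (intro continuous_on_clamp DERIV_continuous_on[OF deriv]) auto
  have h: "continuous_on UNIV h"
    unfolding h_def cl_def using t by (intro continuous_on_clamp g) auto
  \<comment> \<open>At interior times the derivative within [0, T] is two-sided, as
    \<open>deriv\<close> in the definition of \<open>caputo\<close> requires.\<close>
  have du: "(u x has_real_derivative h s) (at s)" if "0 < s" "s < T" for s
    using deriv[of s] that by (simp add: h_def cl at_within_Icc_at)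
  have dv: "(v has_real_derivative h s) (at s)" if "0 < s" "s < t" for s
  \<comment> \<open>The clamped function agrees with \<open>u x\<close> on the open interval (0, T),
    a neighbourhood of \<open>s\<close>, and therefore has the same derivative there.\<close>
  proof (rule DERIV_cong_ev[OF refl _ refl, THEN iffD1])
    show "(u x has_real_derivative h s) (at s)" using du that t by simp
    have "\<forall>\<^sub>F y in nhds s. y \<in> {0<..<T}"
      using that t by (intro eventually_nhds_in_open) auto
    then show "\<forall>\<^sub>F y in nhds s. u x y = v y"
      by eventually_elim (simp add: v_def cl)
  qed
  have [measurable]: "v \<in> borel_measurable borel" "h \<in> borel_measurable borel"
    using v h by (auto intro: borel_measurable_continuous_onI)
  have \<tau>: "continuous_on UNIV (\<tau> r)" "0 < \<tau> r \<gamma>" "\<tau> r \<gamma> < 1" if "r \<in> {1..m}" for r \<gamma>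
    using that \<theta> ab unfolding \<tau>_def by (auto intro!: continuous_on_clamp)
  note E = distributed_order_energy[OF \<tau> \<omega> t(1) v h dv]
  have caputo: "P_caputo m a b \<omega> \<theta> u x s
     = (\<Sum>r=1..m. LINT \<gamma>:{a..b}|lebesgue. \<omega> r x \<gamma> * (rGamma (1 - \<tau> r \<gamma>) * abel (\<tau> r \<gamma>) h s))"
    if s: "0 < s" "s \<le> t" for s
  proof -
    have c: "caputo (\<theta> r x \<gamma>) (u x) s = rGamma (1 - \<theta> r x \<gamma>) * abel (\<theta> r x \<gamma>) h s" for r \<gamma>
      using s t by (intro caputo_eq_abel du) auto
    have "P_caputo m a b \<omega> \<theta> u x s
       = (LINT \<gamma>:{a..b}|lebesgue. \<Sum>r=1..m. \<omega> r x \<gamma> * (rGamma (1 - \<tau> r \<gamma>) * abel (\<tau> r \<gamma>) h s))"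
      unfolding P_caputo_def by (rule set_lebesgue_integral_cong) (auto simp: c \<tau>_eq)
    also have "\<dots> = (\<Sum>r=1..m. LINT \<gamma>:{a..b}|lebesgue. \<omega> r x \<gamma> * (rGamma (1 - \<tau> r \<gamma>) * abel (\<tau> r \<gamma>) h s))"
      by (intro set_lebesgue_integral_sum(2) E(1) s)
    finally show ?thesis .
  qed
  have rl: "P_rl m a b \<omega> \<theta> (\<lambda>y s. (u y s)\<^sup>2) x t
     = (\<Sum>r=1..m. LINT \<gamma>:{a..b}|lebesgue. \<omega> r x \<gamma> * (rGamma (1 - \<tau> r \<gamma>) * abel (\<tau> r \<gamma>) (\<lambda>\<eta>. (v \<eta>)\<^sup>2) t))"
  proof -
    have "(\<lambda>\<eta>. (v \<eta>)\<^sup>2) \<in> borel_measurable borel" by measurable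
    then have c: "rl_integral (1 - \<theta> r x \<gamma>) (\<lambda>s. (u x s)\<^sup>2) t
        = rGamma (1 - \<theta> r x \<gamma>) * abel (\<theta> r x \<gamma>) (\<lambda>\<eta>. (v \<eta>)\<^sup>2) t" for r \<gamma>
      using t by (intro rl_integral_eq_abel) (auto simp: v_def cl)
    have "P_rl m a b \<omega> \<theta> (\<lambda>y s. (u y s)\<^sup>2) x t
       = (LINT \<gamma>:{a..b}|lebesgue. \<Sum>r=1..m. \<omega> r x \<gamma> * (rGamma (1 - \<tau> r \<gamma>) * abel (\<tau> r \<gamma>) (\<lambda>\<eta>. (v \<eta>)\<^sup>2) t))"
      unfolding P_rl_def by (rule set_lebesgue_integral_cong) (auto simp: c \<tau>_eq)
    also have "\<dots> = (\<Sum>r=1..m. LINT \<gamma>:{a..b}|lebesgue. \<omega> r x \<gamma> * (rGamma (1 - \<tau> r \<gamma>) * abel (\<tau> r \<gamma>) (\<lambda>\<eta>. (v \<eta>)\<^sup>2) t))"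
      by (intro set_lebesgue_integral_sum(2) E(2))
    finally show ?thesis .
  qed
  have ini: "(LINT \<gamma>:{a..b}|lebesgue. \<Sum>r=1..m. \<omega> r x \<gamma> * t powr (1 - \<theta> r x \<gamma>) / Gamma (2 - \<theta> r x \<gamma>))
     = (\<Sum>r=1..m. LINT \<gamma>:{a..b}|lebesgue. \<omega> r x \<gamma> * (t powr (1 - \<tau> r \<gamma>) * rGamma (2 - \<tau> r \<gamma>)))"
  proof -
    have "(LINT \<gamma>:{a..b}|lebesgue. \<Sum>r=1..m. \<omega> r x \<gamma> * t powr (1 - \<theta> r x \<gamma>) / Gamma (2 - \<theta> r x \<gamma>))
       = (LINT \<gamma>:{a..b}|lebesgue. \<Sum>r=1..m. \<omega> r x \<gamma> * (t powr (1 - \<tau> r \<gamma>) * rGamma (2 - \<tau> r \<gamma>)))"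
      by (rule set_lebesgue_integral_cong) (auto simp: \<tau>_eq rGamma_inverse_Gamma divide_inverse mult.assoc)
    also have "\<dots> = (\<Sum>r=1..m. LINT \<gamma>:{a..b}|lebesgue. \<omega> r x \<gamma> * (t powr (1 - \<tau> r \<gamma>) * rGamma (2 - \<tau> r \<gamma>)))"
      by (intro set_lebesgue_integral_sum(2) E(3))
    finally show ?thesis .
  qed
  have v0: "v 0 = u x 0" using t by (simp add: v_def cl)
  have "1/2 * (P_rl m a b \<omega> \<theta> (\<lambda>y s. (u y s)\<^sup>2) x t
           - (u x 0)\<^sup>2 * (LINT \<gamma>:{a..b}|lebesgue. \<Sum>r=1..m. \<omega> r x \<gamma> * t powr (1 - \<theta> r x \<gamma>) / Gamma (2 - \<theta> r x \<gamma>)))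
     = (\<Sum>r=1..m. 1/2 * ((LINT \<gamma>:{a..b}|lebesgue. \<omega> r x \<gamma> * (rGamma (1 - \<tau> r \<gamma>) * abel (\<tau> r \<gamma>) (\<lambda>\<eta>. (v \<eta>)\<^sup>2) t))
         - (v 0)\<^sup>2 * (LINT \<gamma>:{a..b}|lebesgue. \<omega> r x \<gamma> * (t powr (1 - \<tau> r \<gamma>) * rGamma (2 - \<tau> r \<gamma>)))))"
    unfolding rl ini v0 by (simp only: sum_distrib_left sum_subtractf[symmetric])
  also have "\<dots> \<le> (\<Sum>r=1..m. LINT s:{0<..<t}|lborel. v s *
      (LINT \<gamma>:{a..b}|lebesgue. \<omega> r x \<gamma> * (rGamma (1 - \<tau> r \<gamma>) * abel (\<tau> r \<gamma>) h s)))"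
    by (intro sum_mono E(5))
  also have "\<dots> = (LINT s:{0<..<t}|lborel. \<Sum>r=1..m. v s *
      (LINT \<gamma>:{a..b}|lebesgue. \<omega> r x \<gamma> * (rGamma (1 - \<tau> r \<gamma>) * abel (\<tau> r \<gamma>) h s)))"
    by (intro set_lebesgue_integral_sum(2)[symmetric] E(4))
  also have "\<dots> = (LINT s:{0<..<t}|lborel. u x s * P_caputo m a b \<omega> \<theta> u x s)"
    using t by (intro set_lebesgue_integral_cong) (auto simp: caputo v_def cl sum_distrib_left)
  finally show ?thesis .
qed

section \<open>Integrability in space at a fixed time\<close>

lemma weighted_section_integral_integrable:
  fixes w f :: "real \<Rightarrow> real \<Rightarrow> real"
  assumes w: "set_integrable lebesgue ({c..d} \<times> {a..b}) (\<lambda>(x, y). w x y)"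
    and sections: "\<And>x. x \<in> {c..d} \<Longrightarrow> set_integrable lebesgue {a..b} (w x)"
    and f: "(\<lambda>(x, y). f x y) \<in> borel_measurable borel"
    and N: "\<And>x y. x \<in> {c..d} \<Longrightarrow> y \<in> {a..b} \<Longrightarrow> \<bar>f x y\<bar> \<le> N"
  shows "\<And>x. x \<in> {c..d} \<Longrightarrow> set_integrable lebesgue {a..b} (\<lambda>y. w x y * f x y)"
    and "set_integrable lebesgue {c..d} (\<lambda>x. LINT y:{a..b}|lebesgue. w x y * f x y)"
proof -
  show i: "set_integrable lebesgue {a..b} (\<lambda>y. w x y * f x y)" if "x \<in> {c..d}" for x
  proof (rule set_integrable_weight_mult[OF sections[OF that] _ N[OF that]])
    have "(\<lambda>y. (\<lambda>(x, y). f x y) (x, y)) \<in> borel_measurable borel"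
      by (rule measurable_compose[OF _ f]) (simp add: borel_prod[symmetric])
    then show "f x \<in> borel_measurable lebesgue"
      by (simp add: measurable_completion)
  qed
  \<comment> \<open>A bounded Borel factor preserves joint integrability of the weight on the
    rectangle, so the result on section integrals applies to the product.\<close>
  have "set_integrable lebesgue ({c..d} \<times> {a..b}) (\<lambda>p. (\<lambda>(x, y). w x y) p * (\<lambda>(x, y). f x y) p)"
    by (rule set_integrable_weight_mult[OF w, of _ N]) (use f N in \<open>auto simp: measurable_completion\<close>)
  then show "set_integrable lebesgue {c..d} (\<lambda>x. LINT y:{a..b}|lebesgue. w x y * f x y)"
    by (intro section_integral_integrable i) (simp_all add: split_beta')
qed

lemma compact_rectangle_bounded:
  fixes g :: "real \<Rightarrow> real \<Rightarrow> real"
  assumes "continuous_on ({a..b} \<times> {c..d}) (\<lambda>(x, y). g x y)"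
  obtains M where "\<And>x y. x \<in> {a..b} \<Longrightarrow> y \<in> {c..d} \<Longrightarrow> \<bar>g x y\<bar> \<le> M"
proof -
  have "bounded ((\<lambda>(x, y). g x y) ` ({a..b} \<times> {c..d}))"
    by (intro compact_imp_bounded compact_continuous_image assms compact_Times) auto
  then obtain M where "\<forall>y \<in> (\<lambda>(x, y). g x y) ` ({a..b} \<times> {c..d}). norm y \<le> M"
    unfolding bounded_iff by blast
  then show thesis by (intro that[of M]) auto
qed

text \<open>Apart from the weight, each integrand is bounded and, after clamping its arguments,
  jointly Borel in x and the order parameter. All the lack of regularity thus sits in the weight. In
  the estimate the lemma is applied to the squares of the solution and of the initial value.\<close>

lemma P_rl_integrable:
  fixes u :: "real \<Rightarrow> real \<Rightarrow> real" and u0 :: "real \<Rightarrow> real"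
  assumes l: "0 < l" and ab: "a < b" and t: "0 < t" "t \<le> T"
    and \<theta>: "\<And>r. r \<in> {1..m} \<Longrightarrow> continuous_on ({0..l} \<times> {a..b}) (\<lambda>(x, \<gamma>). \<theta> r x \<gamma>)"
      "\<And>r x \<gamma>. r \<in> {1..m} \<Longrightarrow> x \<in> {0..l} \<Longrightarrow> \<gamma> \<in> {a..b} \<Longrightarrow> 0 < \<theta> r x \<gamma> \<and> \<theta> r x \<gamma> < 1"
    and \<omega>: "\<And>r. r \<in> {1..m} \<Longrightarrow> set_integrable lebesgue ({0..l} \<times> {a..b}) (\<lambda>(x, \<gamma>). \<omega> r x \<gamma>)"
      "\<And>r x. r \<in> {1..m} \<Longrightarrow> x \<in> {0..l} \<Longrightarrow> set_integrable lebesgue {a..b} (\<lambda>\<gamma>. \<omega> r x \<gamma>)"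
    and u: "continuous_on ({0..l} \<times> {0..T}) (\<lambda>(x, t). u x t)"
    and u0: "continuous_on {0..l} u0"
  shows "set_integrable lebesgue {0..l} (\<lambda>x. P_rl m a b \<omega> \<theta> u x t)"
    and "set_integrable lebesgue {0..l} (\<lambda>x. u0 x *
           (LINT \<gamma>:{a..b}|lebesgue. \<Sum>r=1..m. \<omega> r x \<gamma> * t powr (1 - \<theta> r x \<gamma>) / Gamma (2 - \<theta> r x \<gamma>)))"
proof -
  define cx where "cx x = max 0 (min l x)" for x :: real
  define ct where "ct s = max 0 (min T s)" for s :: real
  define cg where "cg \<gamma> = max a (min b \<gamma>)" for \<gamma> :: real
  have cx: "cx x = x" if "x \<in> {0..l}" for x using that by (simp add: cx_def)
  have ct: "ct s = s" if "0 \<le> s" "s \<le> T" for s using that by (simp add: ct_def)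
  have cg: "cg \<gamma> = \<gamma>" if "\<gamma> \<in> {a..b}" for \<gamma> using that by (simp add: cg_def)
  define \<tau> where "\<tau> r x \<gamma> = \<theta> r (cx x) (cg \<gamma>)" for r x \<gamma>
  define U where "U x s = u (cx x) (ct s)" for x s
  have \<tau>_eq: "\<tau> r x \<gamma> = \<theta> r x \<gamma>" if "x \<in> {0..l}" "\<gamma> \<in> {a..b}" for r x \<gamma>
    using that by (simp add: \<tau>_def cx cg)
  have U: "continuous_on UNIV (\<lambda>(x, s). U x s)"
    unfolding U_def cx_def ct_def using u l t by (intro continuous_on_clamp2) auto
  have Uc: "continuous_on UNIV (U x)" for x
  proof -
    have "continuous_on UNIV (\<lambda>s. (x, s :: real))"
      by (intro continuous_on_Pair continuous_on_const continuous_on_id)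
    from continuous_on_compose2[OF U this] show ?thesis by simp
  qed
  have \<tau>c: "continuous_on UNIV (\<lambda>(x, \<gamma>). \<tau> r x \<gamma>)" if "r \<in> {1..m}" for r
    unfolding \<tau>_def cx_def cg_def using l ab by (intro continuous_on_clamp2 \<theta>(1)[OF that]) auto
  have \<tau>_bd: "0 < \<tau> r x \<gamma>" "\<tau> r x \<gamma> < 1" if "r \<in> {1..m}" for r x \<gamma>
    using \<theta>(2)[OF that, of "cx x" "cg \<gamma>"] l ab by (auto simp: \<tau>_def cx_def cg_def)
  have Um: "(\<lambda>p. U (fst p) (snd p)) \<in> borel_measurable borel"
    using borel_measurable_continuous_onI[OF U] by (simp add: split_beta')
  have \<tau>m: "(\<lambda>p. \<tau> r (fst p) (snd p)) \<in> borel_measurable borel" if "r \<in> {1..m}" for r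
    using borel_measurable_continuous_onI[OF \<tau>c[OF that]] by (simp add: split_beta')
  have rGb [measurable]: "(rGamma :: real \<Rightarrow> real) \<in> borel_measurable borel"
    by (intro borel_measurable_continuous_onI continuous_on_rGamma)
  obtain K where K: "\<And>x s. x \<in> {0..l} \<Longrightarrow> s \<in> {0..T} \<Longrightarrow> \<bar>u x s\<bar> \<le> K"
    using compact_rectangle_bounded[OF u] by metis
  have K0: "0 \<le> K" using K[of 0 0] l t by auto
  have UK: "\<bar>U x s\<bar> \<le> K" for x s
    using K[of "cx x" "ct s"] l t by (auto simp: U_def cx_def ct_def)
  \<comment> \<open>The cofactors of \<open>\<omega> r x \<gamma>\<close> in the two integrands. The
    initial value is put into \<open>f2\<close>, inside the integral over the order, so that both
    terms have the same form.\<close>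
  define f1 where "f1 r x \<gamma> = rGamma (1 - \<tau> r x \<gamma>) * abel (\<tau> r x \<gamma>) (U x) t" for r x \<gamma>
  define f2 where "f2 r x \<gamma> = u0 (cx x) * (t powr (1 - \<tau> r x \<gamma>) * rGamma (2 - \<tau> r x \<gamma>))" for r x \<gamma>
  have f1m: "(\<lambda>(x, \<gamma>). f1 r x \<gamma>) \<in> borel_measurable borel" if r: "r \<in> {1..m}" for r
  proof -
    note [measurable] = \<tau>m[OF r]
    have "(\<lambda>z. (\<lambda>p. U (fst p) (snd p)) (fst (fst z), snd z)) \<in> borel_measurable ((borel :: (real \<times> real) measure) \<Otimes>\<^sub>M (borel :: real measure))"
      by (rule measurable_compose[OF _ Um])
         (simp add: borel_prod[symmetric])
    then show ?thesis
      unfolding f1_def split_beta' 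
      by (intro borel_measurable_times measurable_abel) (measurable, simp add: split_beta')
  qed
  have g2: "continuous_on UNIV (\<lambda>p. rGamma (2 - \<tau> r (fst p) (snd p)))" if "r \<in> {1..m}" for r
    using \<tau>c[OF that]
    by (intro continuous_on_compose2[OF continuous_on_rGamma[of UNIV]] continuous_intros) (auto simp: split_beta')
  have f1b: "\<exists>N. \<forall>x\<in>{0..l}. \<forall>\<gamma>\<in>{a..b}. \<bar>f1 r x \<gamma>\<bar> \<le> N" if r: "r \<in> {1..m}" for r
  proof -
    obtain B where B: "\<And>x \<gamma>. x \<in> {0..l} \<Longrightarrow> \<gamma> \<in> {a..b} \<Longrightarrow> \<bar>rGamma (2 - \<tau> r x \<gamma>)\<bar> \<le> B"
      using compact_rectangle_bounded[of 0 l a b "\<lambda>x \<gamma>. rGamma (2 - \<tau> r x \<gamma>)"] continuous_on_subset[OF g2[OF r]]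
      by (auto simp: split_beta')
    have "\<bar>f1 r x \<gamma>\<bar> \<le> B * (K * (1 + t))" if x: "x \<in> {0..l}" "\<gamma> \<in> {a..b}" for x \<gamma>
    proof -
      have "\<bar>f1 r x \<gamma>\<bar> \<le> \<bar>rGamma (2 - \<tau> r x \<gamma>)\<bar> * (\<bar>K\<bar> * (1 + t))"
        unfolding f1_def using UK t \<tau>_bd[OF r] Uc
        by (intro rGamma_abel_bound borel_measurable_continuous_onI) auto
      also have "\<dots> \<le> B * (K * (1 + t))"
        using B[OF x] K0 t by (intro mult_mono) auto
      finally show ?thesis .
    qed
    then show ?thesis by blast
  qed
  have f2c: "continuous_on UNIV (\<lambda>(x, \<gamma>). f2 r x \<gamma>)" if r: "r \<in> {1..m}" for r
  proof -
    have "continuous_on UNIV (\<lambda>p. u0 (cx (fst p)))"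
      unfolding cx_def using l
      by (intro continuous_on_compose2[OF continuous_on_clamp[OF u0]] continuous_intros) auto
    then show ?thesis
      using \<tau>c[OF r] g2[OF r] t unfolding f2_def split_beta'
      by (intro continuous_intros) auto
  qed
  have f2b: "\<exists>N. \<forall>x\<in>{0..l}. \<forall>\<gamma>\<in>{a..b}. \<bar>f2 r x \<gamma>\<bar> \<le> N" if r: "r \<in> {1..m}" for r
    using compact_rectangle_bounded[OF continuous_on_subset[OF f2c[OF r]]] by (metis subset_UNIV)
  have F1: "set_integrable lebesgue {a..b} (\<lambda>\<gamma>. \<omega> r x \<gamma> * f1 r x \<gamma>)"
      "set_integrable lebesgue {0..l} (\<lambda>x. LINT \<gamma>:{a..b}|lebesgue. \<omega> r x \<gamma> * f1 r x \<gamma>)"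
    if "r \<in> {1..m}" "x \<in> {0..l}" for r x
    using f1b[OF that(1)] weighted_section_integral_integrable[OF \<omega>(1)[OF that(1)] \<omega>(2)[OF that(1)] f1m[OF that(1)]] that(2)
    by blast+
  have F2: "set_integrable lebesgue {a..b} (\<lambda>\<gamma>. \<omega> r x \<gamma> * f2 r x \<gamma>)"
      "set_integrable lebesgue {0..l} (\<lambda>x. LINT \<gamma>:{a..b}|lebesgue. \<omega> r x \<gamma> * f2 r x \<gamma>)"
    if "r \<in> {1..m}" "x \<in> {0..l}" for r x
    using f2b[OF that(1)] weighted_section_integral_integrable[OF \<omega>(1)[OF that(1)] \<omega>(2)[OF that(1)]
        borel_measurable_continuous_onI[OF f2c[OF that(1)]]] that(2)
    by blast+
  have l0: "0 \<in> {0..l}" using l by simp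
  have "set_integrable lebesgue {0..l} (\<lambda>x. \<Sum>r=1..m. LINT \<gamma>:{a..b}|lebesgue. \<omega> r x \<gamma> * f1 r x \<gamma>)"
    by (intro set_lebesgue_integral_sum(1) F1(2)[OF _ l0])
  moreover have "P_rl m a b \<omega> \<theta> u x t = (\<Sum>r=1..m. LINT \<gamma>:{a..b}|lebesgue. \<omega> r x \<gamma> * f1 r x \<gamma>)"
    if x: "x \<in> {0..l}" for x
  proof -
    have c: "rl_integral (1 - \<theta> r x \<gamma>) (u x) t = rGamma (1 - \<theta> r x \<gamma>) * abel (\<theta> r x \<gamma>) (U x) t" for r \<gamma>
      using t x by (intro rl_integral_eq_abel borel_measurable_continuous_onI Uc) (auto simp: U_def ct cx)
    have "P_rl m a b \<omega> \<theta> u x t = (LINT \<gamma>:{a..b}|lebesgue. \<Sum>r=1..m. \<omega> r x \<gamma> * f1 r x \<gamma>)"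
      unfolding P_rl_def by (rule set_lebesgue_integral_cong) (use x in \<open>auto simp: c f1_def \<tau>_eq\<close>)
    also have "\<dots> = (\<Sum>r=1..m. LINT \<gamma>:{a..b}|lebesgue. \<omega> r x \<gamma> * f1 r x \<gamma>)"
      by (intro set_lebesgue_integral_sum(2) F1(1) x)
    finally show ?thesis .
  qed
  ultimately show "set_integrable lebesgue {0..l} (\<lambda>x. P_rl m a b \<omega> \<theta> u x t)"
    by (subst set_integrable_cong[OF refl refl]) auto
  have "set_integrable lebesgue {0..l} (\<lambda>x. \<Sum>r=1..m. LINT \<gamma>:{a..b}|lebesgue. \<omega> r x \<gamma> * f2 r x \<gamma>)"
    by (intro set_lebesgue_integral_sum(1) F2(2)[OF _ l0])
  moreover have "u0 x * (LINT \<gamma>:{a..b}|lebesgue. \<Sum>r=1..m. \<omega> r x \<gamma> * t powr (1 - \<theta> r x \<gamma>) / Gamma (2 - \<theta> r x \<gamma>))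
      = (\<Sum>r=1..m. LINT \<gamma>:{a..b}|lebesgue. \<omega> r x \<gamma> * f2 r x \<gamma>)"
    if x: "x \<in> {0..l}" for x
  proof -
    have "u0 x * (LINT \<gamma>:{a..b}|lebesgue. \<Sum>r=1..m. \<omega> r x \<gamma> * t powr (1 - \<theta> r x \<gamma>) / Gamma (2 - \<theta> r x \<gamma>))
       = (LINT \<gamma>:{a..b}|lebesgue. \<Sum>r=1..m. \<omega> r x \<gamma> * f2 r x \<gamma>)"
      unfolding set_integral_mult_right[symmetric]
      by (rule set_lebesgue_integral_cong)
         (use x in \<open>auto simp: f2_def \<tau>_eq cx sum_distrib_left rGamma_inverse_Gamma divide_inverse mult_ac\<close>)
    also have "\<dots> = (\<Sum>r=1..m. LINT \<gamma>:{a..b}|lebesgue. \<omega> r x \<gamma> * f2 r x \<gamma>)"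
      by (intro set_lebesgue_integral_sum(2) F2(1) x)
    finally show ?thesis .
  qed
  ultimately show "set_integrable lebesgue {0..l} (\<lambda>x. u0 x *
           (LINT \<gamma>:{a..b}|lebesgue. \<Sum>r=1..m. \<omega> r x \<gamma> * t powr (1 - \<theta> r x \<gamma>) / Gamma (2 - \<theta> r x \<gamma>)))"
    by (subst set_integrable_cong[OF refl refl]) auto
qed

section \<open>Continuous integrands on the rectangle and the final estimate\<close>

lemma differentiable_imp_has_real_derivative_vector_derivative:
  fixes f :: "real \<Rightarrow> real"
  assumes "f differentiable (at x within S)"
  shows "(f has_real_derivative vector_derivative f (at x within S)) (at x within S)"
  using assms by (simp add: vector_derivative_works has_real_derivative_iff_has_vector_derivative)

lemma set_lebesgue_integral_eq_integral_continuous: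
  fixes h :: "real \<Rightarrow> real"
  assumes "continuous_on {a..b} h"
  shows "(LINT x:{a..b}|lebesgue. h x) = integral {a..b} h"
  by (intro set_lebesgue_integral_eq_integral(2) absolutely_integrable_continuous_real assms)

lemma continuous_on_integral_rectangle:
  fixes h :: "real \<Rightarrow> real \<Rightarrow> real"
  assumes h: "continuous_on ({a..b} \<times> {c..d}) (\<lambda>(x, s). h x s)"
  shows "continuous_on {a..b} (\<lambda>x. integral {c..d} (h x))"
    and "continuous_on {c..d} (\<lambda>s. integral {a..b} (\<lambda>x. h x s))"
    and "integral {a..b} (\<lambda>x. integral {c..d} (h x)) = integral {c..d} (\<lambda>s. integral {a..b} (\<lambda>x. h x s))"
proof -
  show "continuous_on {a..b} (\<lambda>x. integral {c..d} (h x))"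
    using integral_continuous_on_param[of "{a..b}" c d h] h by simp
  have "continuous_on ({c..d} \<times> {a..b}) (\<lambda>p. (snd p, fst p))"
    by (intro continuous_intros)
  from continuous_on_compose2[OF h this]
  have "continuous_on ({c..d} \<times> {a..b}) (\<lambda>(s, x). h x s)"
    by (simp add: split_beta' image_subset_iff)
  then show "continuous_on {c..d} (\<lambda>s. integral {a..b} (\<lambda>x. h x s))"
    using integral_continuous_on_param[of "{c..d}" a b "\<lambda>s x. h x s"] by simp
  show "integral {a..b} (\<lambda>x. integral {c..d} (h x)) = integral {c..d} (\<lambda>s. integral {a..b} (\<lambda>x. h x s))"
    using integral_swap_continuous[of a c b d h] h by (simp add: cbox_Pair_eq)
qed

theorem theorem1:
  fixes l T \<alpha> \<beta> c1 c2 :: real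
    and m :: nat
    and \<theta> \<omega> :: "nat \<Rightarrow> real \<Rightarrow> real \<Rightarrow> real"
    and k q f u :: "real \<Rightarrow> real \<Rightarrow> real"
    and u0 :: "real \<Rightarrow> real"
  assumes "l > 0" and "T > 0" and "\<alpha> < \<beta>" and "m \<ge> 1"
    and "\<And>r. r \<in> {1..m} \<Longrightarrow> continuous_on ({0..l} \<times> {\<alpha>..\<beta>}) (\<lambda>(x, \<gamma>). \<theta> r x \<gamma>)"
    and "\<And>r x \<gamma>. r \<in> {1..m} \<Longrightarrow> x \<in> {0..l} \<Longrightarrow> \<gamma> \<in> {\<alpha>..\<beta>} \<Longrightarrow> 0 < \<theta> r x \<gamma> \<and> \<theta> r x \<gamma> < 1"
    and "\<And>r x \<gamma>. r \<in> {1..m} \<Longrightarrow> x \<in> {0..l} \<Longrightarrow> \<gamma> \<in> {\<alpha>..\<beta>} \<Longrightarrow> \<omega> r x \<gamma> \<ge> 0"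
    and "\<And>r. r \<in> {1..m} \<Longrightarrow> set_integrable lebesgue ({0..l} \<times> {\<alpha>..\<beta>}) (\<lambda>(x, \<gamma>). \<omega> r x \<gamma>)"
    and "\<And>r x. r \<in> {1..m} \<Longrightarrow> x \<in> {0..l} \<Longrightarrow> set_integrable lebesgue {\<alpha>..\<beta>} (\<lambda>\<gamma>. \<omega> r x \<gamma>)"
    and "\<And>x. x \<in> {0..l} \<Longrightarrow> (LINT \<gamma>:{\<alpha>..\<beta>}|lebesgue. \<Sum>r=1..m. \<omega> r x \<gamma>) > 0"
    and "C_class l T 1 0 k"
    and "continuous_on ({0..l} \<times> {0..T}) (\<lambda>(x, t). q x t)"
    and "continuous_on ({0..l} \<times> {0..T}) (\<lambda>(x, t). f x t)"
    and "c1 > 0"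
    and "\<And>x t. x \<in> {0..l} \<Longrightarrow> t \<in> {0..T} \<Longrightarrow> c1 \<le> k x t \<and> k x t \<le> c2"
    and "\<And>x t. x \<in> {0..l} \<Longrightarrow> t \<in> {0..T} \<Longrightarrow> q x t \<ge> 0"
    and "C_class l T 2 1 u"
    and "\<And>x t. 0 < x \<Longrightarrow> x < l \<Longrightarrow> 0 < t \<Longrightarrow> t \<le> T \<Longrightarrow>
           P_caputo m \<alpha> \<beta> \<omega> \<theta> u x t =
             partial_x l (\<lambda>y s. k y s * partial_x l u y s) x t - q x t * u x t + f x t"
    and "\<And>t. t \<in> {0..T} \<Longrightarrow> u 0 t = 0"
    and "\<And>t. t \<in> {0..T} \<Longrightarrow> u l t = 0"
    and "\<And>x. x \<in> {0..l} \<Longrightarrow> u x 0 = u0 x"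
  shows "\<forall>t\<in>{0<..T}.
      (LINT x:{0..l}|lebesgue. P_rl m \<alpha> \<beta> \<omega> \<theta> (\<lambda>y s. (u y s)\<^sup>2) x t)
        + c1 * (LINT s:{0..t}|lebesgue. norm0_sq l (\<lambda>x. partial_x l u x s))
      \<le> l\<^sup>2 / (2 * c1) * (LINT s:{0..t}|lebesgue. norm0_sq l (\<lambda>x. f x s))
        + (LINT x:{0..l}|lebesgue. (u0 x)\<^sup>2 *
             (LINT \<gamma>:{\<alpha>..\<beta>}|lebesgue.
                \<Sum>r=1..m. \<omega> r x \<gamma> * t powr (1 - \<theta> r x \<gamma>) / Gamma (2 - \<theta> r x \<gamma>)))"
proof
  fix t assume t: "t \<in> {0<..T}"
  note l = assms(1) and c1 = assms(14)
  define ux where "ux = partial_x l u"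
  define uxx where "uxx = partial_x l ux"
  define ut where "ut = partial_t T u"
  define kx where "kx = partial_x l k"
  have du: "((\<lambda>y. u y s) has_real_derivative ux x s) (at x within {0..l})"
    and dux: "((\<lambda>y. ux y s) has_real_derivative uxx x s) (at x within {0..l})"
    and dut: "(u x has_real_derivative ut x s) (at s within {0..T})"
    and dk: "((\<lambda>y. k y s) has_real_derivative kx x s) (at x within {0..l})"
    if "x \<in> {0..l}" "s \<in> {0..T}" for x s
  proof -
    have *: "(\<lambda>y. (partial_x l ^^ i) u y s) differentiable (at x within {0..l})" if "i < 2" for i
      using assms(17) that \<open>x \<in> {0..l}\<close> \<open>s \<in> {0..T}\<close> unfolding C_class_def by blast
    have **: "(\<lambda>s. (partial_t T ^^ i) u x s) differentiable (at s within {0..T})" if "i < 1" for i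
      using assms(17) that \<open>x \<in> {0..l}\<close> \<open>s \<in> {0..T}\<close> unfolding C_class_def by blast
    have ***: "(\<lambda>y. (partial_x l ^^ i) k y s) differentiable (at x within {0..l})" if "i < 1" for i
      using assms(11) that \<open>x \<in> {0..l}\<close> \<open>s \<in> {0..T}\<close> unfolding C_class_def by blast
    show "((\<lambda>y. u y s) has_real_derivative ux x s) (at x within {0..l})"
      using differentiable_imp_has_real_derivative_vector_derivative[OF *[of 0]] by (simp add: ux_def partial_x_def)
    show "((\<lambda>y. ux y s) has_real_derivative uxx x s) (at x within {0..l})"
      using differentiable_imp_has_real_derivative_vector_derivative[OF *[of 1]]
      by (simp add: ux_def[symmetric] uxx_def partial_x_def[of l ux])
    show "(u x has_real_derivative ut x s) (at s within {0..T})"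
      using differentiable_imp_has_real_derivative_vector_derivative[OF **[of 0]] by (simp add: ut_def partial_t_def)
    show "((\<lambda>y. k y s) has_real_derivative kx x s) (at x within {0..l})"
      using differentiable_imp_has_real_derivative_vector_derivative[OF ***[of 0]] by (simp add: kx_def partial_x_def)
  qed
  have cont_x: "continuous_on ({0..l} \<times> {0..T}) (\<lambda>(x, s). (partial_x l ^^ i) u x s)" if "i \<le> 2" for i
    using assms(17) that unfolding C_class_def by blast
  have cont_t: "continuous_on ({0..l} \<times> {0..T}) (\<lambda>(x, s). (partial_t T ^^ i) u x s)" if "i \<le> 1" for i
    using assms(17) that unfolding C_class_def by blast
  have cont_k: "continuous_on ({0..l} \<times> {0..T}) (\<lambda>(x, s). (partial_x l ^^ i) k x s)" if "i \<le> 1" for i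
    using assms(11) that unfolding C_class_def by blast
  have cont: "continuous_on ({0..l} \<times> {0..T}) (\<lambda>(x, s). u x s)"
      "continuous_on ({0..l} \<times> {0..T}) (\<lambda>(x, s). ux x s)"
      "continuous_on ({0..l} \<times> {0..T}) (\<lambda>(x, s). uxx x s)"
      "continuous_on ({0..l} \<times> {0..T}) (\<lambda>(x, s). ut x s)"
      "continuous_on ({0..l} \<times> {0..T}) (\<lambda>(x, s). k x s)"
      "continuous_on ({0..l} \<times> {0..T}) (\<lambda>(x, s). kx x s)"
    using cont_x[of 0] cont_x[of 1] cont_x[of 2] cont_t[of 1] cont_k[of 0] cont_k[of 1]
    by (simp_all add: ux_def uxx_def ut_def kx_def numeral_2_eq_2)
  \<comment> \<open>The flux derivative is expanded by the product rule because the classes of k and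
    u give continuity of k_x and u_xx separately.\<close>
  define G where "G x s = kx x s * ux x s + k x s * uxx x s - q x s * u x s + f x s" for x s
  have pde: "P_caputo m \<alpha> \<beta> \<omega> \<theta> u x s = G x s" if x: "0 < x" "x < l" and s: "0 < s" "s \<le> T" for x s
  proof -
    have "((\<lambda>y. k y s * ux y s) has_real_derivative kx x s * ux x s + k x s * uxx x s) (at x within {0..l})"
      using DERIV_mult[OF dk dux] x s by (simp add: algebra_simps)
    then have "vector_derivative (\<lambda>y. k y s * ux y s) (at x within {0..l}) = kx x s * ux x s + k x s * uxx x s"
      using x l by (intro vector_derivative_within_closed_interval)
        (auto simp: has_real_derivative_iff_has_vector_derivative)
    then show ?thesis
      using assms(18)[OF x s] by (simp add: G_def partial_x_def ux_def)
  qed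
  have T: "{0..l} \<times> {0..t} \<subseteq> {0..l} \<times> {0..T}" using t by auto
  note cont_sub = continuous_on_subset[OF _ T]
  have uG: "continuous_on ({0..l} \<times> {0..t}) (\<lambda>(x, s). u x s * G x s)"
    using cont[THEN cont_sub] assms(12,13)[THEN cont_sub]
    unfolding G_def split_beta' by (intro continuous_intros)
  have ux2: "continuous_on ({0..l} \<times> {0..t}) (\<lambda>(x, s). (ux x s)\<^sup>2)"
    using cont(2)[THEN cont_sub] unfolding split_beta' by (intro continuous_intros)
  have f2: "continuous_on ({0..l} \<times> {0..t}) (\<lambda>(x, s). (f x s)\<^sup>2)"
    using assms(13)[THEN cont_sub] unfolding split_beta' by (intro continuous_intros)
  have slice: "continuous_on {0..l} (\<lambda>x. h x s)"
    if "continuous_on ({0..l} \<times> {0..T}) (\<lambda>(x, s). h x s)" "s \<in> {0..T}" for h :: "real \<Rightarrow> real \<Rightarrow> real" and s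
    using continuous_on_compose2[OF that(1), of "{0..l}" "\<lambda>x. (x, s)"] that(2)
    by (simp add: image_subset_iff continuous_on_Pair)
  have slice_t: "continuous_on {0..T} (h x)"
    if "continuous_on ({0..l} \<times> {0..T}) (\<lambda>(x, s). h x s)" "x \<in> {0..l}" for h :: "real \<Rightarrow> real \<Rightarrow> real" and x
  proof -
    have "continuous_on {0..T} (\<lambda>s. (x, s))" by (intro continuous_intros)
    from continuous_on_compose2[OF that(1) this] show ?thesis using that(2) by (simp add: image_subset_iff)
  qed
  have norm_ux: "norm0_sq l (\<lambda>x. ux x s) = integral {0..l} (\<lambda>x. (ux x s)\<^sup>2)" if "s \<in> {0..t}" for s
    unfolding norm0_sq_def using that t
    by (intro set_lebesgue_integral_eq_integral_continuous continuous_intros slice[OF cont(2)]) auto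
  have norm_f: "norm0_sq l (\<lambda>x. f x s) = integral {0..l} (\<lambda>x. (f x s)\<^sup>2)" if "s \<in> {0..t}" for s
    unfolding norm0_sq_def using that t
    by (intro set_lebesgue_integral_eq_integral_continuous continuous_intros slice[OF assms(13)]) auto
  define Iu where "Iu = integral {0..t} (\<lambda>s. integral {0..l} (\<lambda>x. (ux x s)\<^sup>2))"
  define If where "If = integral {0..t} (\<lambda>s. integral {0..l} (\<lambda>x. (f x s)\<^sup>2))"
  have Iu: "(LINT s:{0..t}|lebesgue. norm0_sq l (\<lambda>x. partial_x l u x s)) = Iu"
  proof -
    have "(LINT s:{0..t}|lebesgue. norm0_sq l (\<lambda>x. partial_x l u x s))
        = (LINT s:{0..t}|lebesgue. integral {0..l} (\<lambda>x. (ux x s)\<^sup>2))"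
      by (rule set_lebesgue_integral_cong) (auto simp: norm_ux ux_def[symmetric])
    also have "\<dots> = Iu"
      unfolding Iu_def
      by (intro set_lebesgue_integral_eq_integral_continuous continuous_on_integral_rectangle(2) ux2)
    finally show ?thesis .
  qed
  have If: "(LINT s:{0..t}|lebesgue. norm0_sq l (\<lambda>x. f x s)) = If"
  proof -
    have "(LINT s:{0..t}|lebesgue. norm0_sq l (\<lambda>x. f x s))
        = (LINT s:{0..t}|lebesgue. integral {0..l} (\<lambda>x. (f x s)\<^sup>2))"
      by (rule set_lebesgue_integral_cong) (auto simp: norm_f)
    also have "\<dots> = If"
      unfolding If_def
      by (intro set_lebesgue_integral_eq_integral_continuous continuous_on_integral_rectangle(2) f2)
    finally show ?thesis .
  qed
  \<comment> \<open>The meeting point of the two halves: the spatial energy bounds the integral of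
    \<open>J\<close> from above, and the fractional energy bounds \<open>J x\<close> from below at
    every interior x.\<close>
  define J where "J x = integral {0..t} (\<lambda>s. u x s * G x s)" for x
  have J_cont: "continuous_on {0..l} J"
    unfolding J_def by (rule continuous_on_integral_rectangle(1)[OF uG])
  have energy: "integral {0..l} J + c1 / 2 * Iu \<le> l\<^sup>2 / (4 * c1) * If"
  proof -
    have 1: "((\<lambda>s. integral {0..l} (\<lambda>x. u x s * G x s) + c1 / 2 * integral {0..l} (\<lambda>x. (ux x s)\<^sup>2))
        has_integral (integral {0..t} (\<lambda>s. integral {0..l} (\<lambda>x. u x s * G x s)) + c1 / 2 * Iu)) {0..t}"
      unfolding Iu_def
      by (intro has_integral_add has_integral_mult_right integrable_integral integrable_continuous_real
          continuous_on_integral_rectangle(2)[OF ux2] continuous_on_integral_rectangle(2)[OF uG])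
    have 2: "((\<lambda>s. l\<^sup>2 / (4 * c1) * integral {0..l} (\<lambda>x. (f x s)\<^sup>2)) has_integral l\<^sup>2 / (4 * c1) * If) {0..t}"
      unfolding If_def
      by (intro has_integral_mult_right integrable_integral integrable_continuous_real
          continuous_on_integral_rectangle(2)[OF f2])
    have "integral {0..t} (\<lambda>s. integral {0..l} (\<lambda>x. u x s * G x s)) + c1 / 2 * Iu \<le> l\<^sup>2 / (4 * c1) * If"
    \<comment> \<open>The spatial estimate holds at every s in [0, t], including s = 0 where the
      equation is not assumed: it concerns the expression \<open>G\<close> and the boundary values
      of u alone.\<close>
    proof (rule has_integral_le[OF 1 2])
      fix s assume "s \<in> {0..t}"
      then have s: "s \<in> {0..T}" using t by auto
      show "integral {0..l} (\<lambda>x. u x s * G x s) + c1 / 2 * integral {0..l} (\<lambda>x. (ux x s)\<^sup>2)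
          \<le> l\<^sup>2 / (4 * c1) * integral {0..l} (\<lambda>x. (f x s)\<^sup>2)"
        unfolding G_def
        using s assms(15,16,19,20)
        by (intro Dirichlet_energy_estimate[OF l c1, of "\<lambda>x. u x s" "\<lambda>x. ux x s" "\<lambda>x. uxx x s" "\<lambda>x. kx x s"
              "\<lambda>x. q x s" "\<lambda>x. f x s" "\<lambda>x. k x s"]
            slice[OF _ s] du dux dk cont assms(12,13)) auto
    qed
    then show ?thesis
      unfolding J_def continuous_on_integral_rectangle(3)[OF uG] .
  qed
  define R where "R x = P_rl m \<alpha> \<beta> \<omega> \<theta> (\<lambda>y s. (u y s)\<^sup>2) x t" for x
  define S where "S x = (u0 x)\<^sup>2 * (LINT \<gamma>:{\<alpha>..\<beta>}|lebesgue.
      \<Sum>r=1..m. \<omega> r x \<gamma> * t powr (1 - \<theta> r x \<gamma>) / Gamma (2 - \<theta> r x \<gamma>))" for x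
  have u2: "continuous_on ({0..l} \<times> {0..T}) (\<lambda>(x, s). (u x s)\<^sup>2)"
    using cont(1) unfolding split_beta' by (intro continuous_intros)
  have "continuous_on {0..l} (\<lambda>x. u x 0)"
    using assms(2) by (intro slice cont) simp
  \<comment> \<open>The initial value inherits its continuity from u, with which it agrees at time
    0.\<close>
  then have "continuous_on {0..l} u0"
    by (rule continuous_on_eq) (simp add: assms(21))
  then have u02: "continuous_on {0..l} (\<lambda>x. (u0 x)\<^sup>2)"
    by (intro continuous_intros)
  have int_R: "set_integrable lebesgue {0..l} R"
    unfolding R_def using t
    by (intro P_rl_integrable(1)[OF l assms(3) _ _ assms(5,6,8,9) u2 u02]) auto
  have int_S: "set_integrable lebesgue {0..l} S"
    unfolding S_def using t
    by (intro P_rl_integrable(2)[OF l assms(3) _ _ assms(5,6,8,9) u2 u02]) auto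
  have pointwise: "1/2 * (R x - S x) \<le> J x" if x: "0 < x" "x < l" for x
  proof -
    have xl: "x \<in> {0..l}" using x by simp
    have \<theta>c: "continuous_on {\<alpha>..\<beta>} (\<theta> r x)" if "r \<in> {1..m}" for r
    proof -
      have "continuous_on {\<alpha>..\<beta>} (\<lambda>\<gamma>. (x, \<gamma>))" by (intro continuous_intros)
      from continuous_on_compose2[OF assms(5)[OF that] this] show ?thesis
        using xl by (simp add: image_subset_iff)
    qed
    have "1/2 * (R x - S x) \<le> (LINT s:{0<..<t}|lborel. u x s * P_caputo m \<alpha> \<beta> \<omega> \<theta> u x s)"
      unfolding R_def S_def assms(21)[OF xl, symmetric]
      using t xl
      by (intro P_caputo_energy[OF assms(3), where g = "ut x" and T = T] \<theta>c assms(6,7,9) slice_t[OF cont(4)] dut) auto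
    also have "\<dots> = (LINT s:{0<..<t}|lborel. u x s * G x s)"
      by (rule set_lebesgue_integral_cong) (use pde[OF x] t in auto)
    \<comment> \<open>The equation substitutes \<open>G\<close> for the fractional term only at
      positive times, hence the open interval; continuity of u times \<open>G\<close> makes the
      endpoints harmless.\<close>
    also have "\<dots> = J x"
    proof -
      have "continuous_on {0..t} (\<lambda>s. (x, s))" by (intro continuous_intros)
      from continuous_on_compose2[OF uG this] have "continuous_on {0..t} (\<lambda>s. u x s * G x s)"
        using xl by (simp add: image_subset_iff)
      then have "set_integrable lborel {0..t} (\<lambda>s. u x s * G x s)"
        by (rule borel_integrable_atLeastAtMost')
      then have "set_integrable lborel {0<..<t} (\<lambda>s. u x s * G x s)"
        by (rule set_integrable_subset) auto
      from set_borel_integral_eq_integral(2)[OF this] show ?thesis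
        by (simp add: J_def integral_open_interval_real)
    qed
    finally show ?thesis .
  qed
  have "1/2 * ((LINT x:{0..l}|lebesgue. R x) - (LINT x:{0..l}|lebesgue. S x))
      = (LINT x:{0..l}|lebesgue. 1/2 * (R x - S x))"
    unfolding set_integral_mult_right set_integral_diff(2)[OF int_R int_S] ..
  also have "\<dots> \<le> (LINT x:{0..l}|lebesgue. J x)"
  \<comment> \<open>At x = 0 and x = l the equation is not assumed, so the lower bound for
    \<open>J\<close> holds only off these two points, a null set.\<close>
  proof (rule set_integral_mono_AE)
    show "set_integrable lebesgue {0..l} (\<lambda>x. 1/2 * (R x - S x))"
      by (intro set_integrable_mult_right set_integral_diff(1) int_R int_S)
    show "set_integrable lebesgue {0..l} J"
      by (rule absolutely_integrable_continuous_real[OF J_cont])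
    have "AE x in lebesgue. x \<noteq> 0" "AE x in lebesgue. x \<noteq> l"
      by (auto intro!: AE_completion AE_lborel_singleton)
    then show "AE x\<in>{0..l} in lebesgue. 1/2 * (R x - S x) \<le> J x"
      by eventually_elim (use pointwise in auto)
  qed
  also have "\<dots> = integral {0..l} J"
    by (rule set_lebesgue_integral_eq_integral_continuous[OF J_cont])
  finally have "1/2 * ((LINT x:{0..l}|lebesgue. R x) - (LINT x:{0..l}|lebesgue. S x)) + c1 / 2 * Iu
      \<le> l\<^sup>2 / (4 * c1) * If"
    using energy by linarith
  moreover have "l\<^sup>2 / (2 * c1) * If = 2 * (l\<^sup>2 / (4 * c1) * If)"
    by simp
  \<comment> \<open>Doubling removes the factor 1/2 from the fractional energy and produces the
    constants \<open>c1\<close> and l^2 / (2 c1).\<close>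
  ultimately have "(LINT x:{0..l}|lebesgue. R x) + c1 * Iu \<le> l\<^sup>2 / (2 * c1) * If + (LINT x:{0..l}|lebesgue. S x)"
    by argo
  then show "(LINT x:{0..l}|lebesgue. P_rl m \<alpha> \<beta> \<omega> \<theta> (\<lambda>y s. (u y s)\<^sup>2) x t)
        + c1 * (LINT s:{0..t}|lebesgue. norm0_sq l (\<lambda>x. partial_x l u x s))
      \<le> l\<^sup>2 / (2 * c1) * (LINT s:{0..t}|lebesgue. norm0_sq l (\<lambda>x. f x s))
        + (LINT x:{0..l}|lebesgue. (u0 x)\<^sup>2 *
             (LINT \<gamma>:{\<alpha>..\<beta>}|lebesgue.
                \<Sum>r=1..m. \<omega> r x \<gamma> * t powr (1 - \<theta> r x \<gamma>) / Gamma (2 - \<theta> r x \<gamma>)))"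
    unfolding R_def S_def Iu If .
qed

end
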